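(* Let $\alpha,\beta>0$ and consider on the Euclidean plane $\mathbb{R}^2$, with coordinates $q=(x,y)$, the electromagnetic system with scalar potential $V(x,y)=-\alpha x^2-\beta y^2$ and magnetic potential $\vartheta=-y\,dx+x\,dy$, i.e. the Hamiltonian system on $T^*\mathbb{R}^2$ with $$H(q,p)=\tfrac12\big[(p_x+y)^2+(p_y-x)^2\big]-\alpha x^2-\beta y^2 .$$ Let $q_0=(0,0)$, let $e_0=\sup_{\mathbb{R}^2}V=0$, let $c_u$ be the Mañé critical value of the system, and for $e>0$ let $K_e$ be its electromagnetic curvature at energy $e$. The following assertions are equivalent: 1. $q_0$ is a linearly stable equilibrium point. 2. $c_u>e_0$. 3. For every $e>0$, we have $K_e(q_0,\cdot)>0$ and, denoting by $\mathcal{C}_e$ the connected component of $\{q\in\mathbb{R}^2 \mid K_e(q,\cdot)>0\}$ containing $q_0$, the boundary $\partial\mathcal{C}_e$ is either empty or given by the two branches of a hyperbola. 4. $\sqrt{\alpha}+\sqrt{\beta}<\sqrt{2}$.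
   Context: Linear stability: the system is linear; with $\dot q=v$ the equations of motion in the variables $(x,y,v_x,v_y)$ are $\dot\zeta=L\zeta$ with $$L=\begin{pmatrix}0&0&1&0\\0&0&0&1\\2\alpha&0&0&2\\0&2\beta&-2&0\end{pmatrix}.$$ The equilibrium $q_0$ is linearly stable if all eigenvalues of $L$ are purely imaginary and $L$ is diagonalizable (over $\mathbb{C}$). Mañé critical value: $c_u=\inf_{f\in C^\infty(\mathbb{R}^2)}\ \sup_{q\in\mathbb{R}^2} H(q,\mathrm{d}f(q))$. Electromagnetic curvature: the energy is $E(q,v)=\tfrac12|v|^2+V(q)$ and $\Sigma_e=E^{-1}(e)$. For an electromagnetic system on an oriented Riemannian surface $(M,g)$ with scalar potential $V$ and magnetic field $\sigma=d\vartheta=b\,\mu_g$ (with $\mu_g$ the area form), the electromagnetic curvature at energy $e$ is the function on $\Sigma_e$ $$K_e(q,v)=\frac{K^g(q)}{2(e-V)}+\frac{\Delta_gV}{4(e-V)^2}+\frac{|\mathrm{d}V|_g^2}{4(e-V)^3}-\frac{\mathrm{d}b[J^g\hat v]}{(2(e-V))^{3/2}}-\frac{2b\,\mathrm{d}V[J^g\hat v]}{(2(e-V))^{5/2}}+\frac{b^2}{4(e-V)^2},$$ where $V,b$ and their derivatives are evaluated at $q$, $K^g$ is the Gaussian curvature, $\hat v=v/|v|_g$, and $J^g$ is the rotation by $+90^\circ$. Here $g$ is Euclidean and $b\equiv2$, so, for $\hat v=(\cos\varphi,\sin\varphi)$, $$K_e(q,v)=\frac{2-\alpha-\beta}{2(e+\alpha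 x^2+\beta y^2)^2}+\frac{\alpha^2x^2+\beta^2y^2}{(e+\alpha x^2+\beta y^2)^3}-\frac{\sqrt2\,(\alpha x\sin\varphi-\beta y\cos\varphi)}{(e+\alpha x^2+\beta y^2)^{5/2}} .$$ The notation $K_e(q,\cdot)>0$ means that $K_e(q,v)>0$ for all $v$ with $(q,v)\in\Sigma_e$, equivalently for all directions $\varphi$.
   Formalization: The implication from assertion 3 to assertion 4 is stated only for (α,β) ≠ (1/2,1/2): at α=β=1/2 the curvature is positive everywhere, so 3 holds with empty boundary, while √α+√β=√2, so 4 fails. All other implications are unrestricted. *)

theory Defs
  imports "HOL-Analysis.Analysis" "Jordan_Normal_Form.Char_Poly"
begin

text \<open>Points, vectors and covectors of the plane are pairs, whose norm is the Euclidean one;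
  a covector is given by its coefficients with respect to dx and dy.\<close>

definition grad :: "(real \<times> real \<Rightarrow> real) \<Rightarrow> real \<times> real \<Rightarrow> real \<times> real" where
  "grad f q = (frechet_derivative f (at q) (1, 0), frechet_derivative f (at q) (0, 1))"

definition laplacian :: "(real \<times> real \<Rightarrow> real) \<Rightarrow> real \<times> real \<Rightarrow> real" where
  "laplacian f q = fst (grad (\<lambda>p. fst (grad f p)) q) + snd (grad (\<lambda>p. snd (grad f p)) q)"

definition rot90 :: "real \<times> real \<Rightarrow> real \<times> real" where
  "rot90 v = (- snd v, fst v)"

text \<open>The function b with d\<theta> = b dx dy.\<close>

definition curl :: "(real \<times> real \<Rightarrow> real \<times> real) \<Rightarrow> real \<times> real \<Rightarrow> real" where
  "curl \<theta> q = fst (grad (\<lambda>p. snd (\<theta> p)) q) - snd (grad (\<lambda>p. fst (\<theta> p)) q)"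

text \<open>The equations of motion q' = v, v' = - grad V - b J v.\<close>

definition em_field ::
  "(real \<times> real \<Rightarrow> real) \<Rightarrow> (real \<times> real \<Rightarrow> real \<times> real) \<Rightarrow>
    (real \<times> real) \<times> (real \<times> real) \<Rightarrow> (real \<times> real) \<times> (real \<times> real)" where
  "em_field V \<theta> = (\<lambda>(q, v). (v, - grad V q - curl \<theta> q *\<^sub>R rot90 v))"

definition energy_level ::
  "(real \<times> real \<Rightarrow> real) \<Rightarrow> real \<Rightarrow> ((real \<times> real) \<times> (real \<times> real)) set" where
  "energy_level V e = {(q, v). (norm v)\<^sup>2 / 2 + V q = e}"

text \<open>The Gaussian curvature term is absent, since the metric is flat.\<close>

definition em_curvature ::
  "(real \<times> real \<Rightarrow> real) \<Rightarrow> (real \<times> real \<Rightarrow> real \<times> real) \<Rightarrow>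
    real \<Rightarrow> real \<times> real \<Rightarrow> real \<times> real \<Rightarrow> real" where
  "em_curvature V \<theta> e q v =
     (let b = curl \<theta>; u = rot90 (v /\<^sub>R norm v); W = e - V q in
        laplacian V q / (4 * W\<^sup>2)
      + (norm (grad V q))\<^sup>2 / (4 * W ^ 3)
      - inner (grad b q) u / (2 * W) powr (3 / 2)
      - 2 * b q * inner (grad V q) u / (2 * W) powr (5 / 2)
      + (b q)\<^sup>2 / (4 * W\<^sup>2))"

definition positive_curvature_set ::
  "(real \<times> real \<Rightarrow> real) \<Rightarrow> (real \<times> real \<Rightarrow> real \<times> real) \<Rightarrow> real \<Rightarrow> (real \<times> real) set" where
  "positive_curvature_set V \<theta> e =
     {q. \<forall>v. (q, v) \<in> energy_level V e \<longrightarrow> em_curvature V \<theta> e q v > 0}"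

fun C_k :: "nat \<Rightarrow> (real \<times> real \<Rightarrow> real) \<Rightarrow> bool" where
  "C_k 0 f \<longleftrightarrow> continuous_on UNIV f"
| "C_k (Suc k) f \<longleftrightarrow> (\<forall>q. f differentiable at q) \<and>
     (\<forall>w. C_k k (\<lambda>q. frechet_derivative f (at q) w))"

definition C_infinity :: "(real \<times> real \<Rightarrow> real) set" where
  "C_infinity = {f. \<forall>k. C_k k f}"

text \<open>The values are extended reals because the supremum can be infinite for every f.\<close>

definition mane_critical_value :: "(real \<times> real \<Rightarrow> real \<times> real \<Rightarrow> real) \<Rightarrow> ereal" where
  "mane_critical_value H = (INF f \<in> C_infinity. SUP q. ereal (H q (grad f q)))"

text \<open>The pair (u, w) is an orthonormal frame along the axes of the hyperbola with centre c;
  the set consists of both branches.\<close>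

definition is_hyperbola :: "(real \<times> real) set \<Rightarrow> bool" where
  "is_hyperbola S \<longleftrightarrow>
     (\<exists>c u w A B. norm u = 1 \<and> norm w = 1 \<and> inner u w = 0 \<and> A > 0 \<and> B > 0 \<and>
        S = {q. (inner (q - c) u)\<^sup>2 / A\<^sup>2 - (inner (q - c) w)\<^sup>2 / B\<^sup>2 = 1})"

definition diagonalizable :: "complex mat \<Rightarrow> bool" where
  "diagonalizable A \<longleftrightarrow> (\<exists>D. diagonal_mat D \<and> similar_mat A D)"

definition V :: "real \<Rightarrow> real \<Rightarrow> real \<times> real \<Rightarrow> real" where
  "V \<alpha> \<beta> = (\<lambda>(x, y). - \<alpha> * x\<^sup>2 - \<beta> * y\<^sup>2)"

definition \<theta> :: "real \<times> real \<Rightarrow> real \<times> real" where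
  "\<theta> = (\<lambda>(x, y). (- y, x))"

definition H :: "real \<Rightarrow> real \<Rightarrow> real \<times> real \<Rightarrow> real \<times> real \<Rightarrow> real" where
  "H \<alpha> \<beta> = (\<lambda>(x, y) (px, py).
     ((px + y)\<^sup>2 + (py - x)\<^sup>2) / 2 - \<alpha> * x\<^sup>2 - \<beta> * y\<^sup>2)"

definition e0 :: "real \<Rightarrow> real \<Rightarrow> ereal" where
  "e0 \<alpha> \<beta> = (SUP q. ereal (V \<alpha> \<beta> q))"

definition L :: "real \<Rightarrow> real \<Rightarrow> complex mat" where
  "L \<alpha> \<beta> = mat_of_rows_list 4
     [[0, 0, 1, 0],
      [0, 0, 0, 1],
      [2 * of_real \<alpha>, 0, 0, 2],
      [0, 2 * of_real \<beta>, - 2, 0]]"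

text \<open>The equations of motion are linear (see \<open>em_field_eq\<close>), so L is
  their linearisation at every equilibrium.\<close>

definition linearly_stable_equilibrium :: "real \<Rightarrow> real \<Rightarrow> real \<times> real \<Rightarrow> bool" where
  "linearly_stable_equilibrium \<alpha> \<beta> q \<longleftrightarrow>
     em_field (V \<alpha> \<beta>) \<theta> (q, 0) = 0 \<and>
     (\<forall>k. eigenvalue (L \<alpha> \<beta>) k \<longrightarrow> Re k = 0) \<and> diagonalizable (L \<alpha> \<beta>)"

definition curvature_condition :: "real \<Rightarrow> real \<Rightarrow> bool" where
  "curvature_condition \<alpha> \<beta> \<longleftrightarrow>
     (\<forall>e > 0.
        let P = positive_curvature_set (V \<alpha> \<beta>) \<theta> e;
            F = frontier (connected_component_set P (0, 0))
        in (0, 0) \<in> P \<and> (F = {} \<or> is_hyperbola F))"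

lemma grad_eqI:
  assumes "(f has_derivative D) (at q)"
  shows "grad f q = (D (1, 0), D (0, 1))"
  using frechet_derivative_at[OF assms] by (simp add: grad_def)

lemma grad_V: "grad (V \<alpha> \<beta>) q = (- 2 * \<alpha> * fst q, - 2 * \<beta> * snd q)"
proof -
  have "V \<alpha> \<beta> = (\<lambda>q. - \<alpha> * (fst q)\<^sup>2 - \<beta> * (snd q)\<^sup>2)"
    by (auto simp: V_def fun_eq_iff)
  moreover have "((\<lambda>q. - \<alpha> * (fst q)\<^sup>2 - \<beta> * (snd q)\<^sup>2) has_derivative
      (\<lambda>h. - \<alpha> * (2 * fst q * fst h) - \<beta> * (2 * snd q * snd h))) (at q)"
    by (auto intro!: derivative_eq_intros ext simp: algebra_simps)
  ultimately show ?thesis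
    using grad_eqI[of "V \<alpha> \<beta>"] by fastforce
qed

lemma laplacian_V: "laplacian (V \<alpha> \<beta>) q = - 2 * \<alpha> - 2 * \<beta>"
proof -
  have "((\<lambda>q. - 2 * \<alpha> * fst q) has_derivative (\<lambda>h. - 2 * \<alpha> * fst h)) (at q)"
    "((\<lambda>q. - 2 * \<beta> * snd q) has_derivative (\<lambda>h. - 2 * \<beta> * snd h)) (at q)" for q :: "real \<times> real"
    by (auto intro!: derivative_eq_intros)
  from grad_eqI[OF this(1)] grad_eqI[OF this(2)] show ?thesis
    by (simp add: laplacian_def grad_V)
qed

lemma curl_\<theta>: "curl \<theta> q = 2"
proof -
  have "(fst has_derivative fst) (at q)" "((\<lambda>q. - snd q) has_derivative (\<lambda>h. - snd h)) (at q)"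
    for q :: "real \<times> real"
    by (auto intro!: derivative_eq_intros)
  from grad_eqI[OF this(1)] grad_eqI[OF this(2)] show ?thesis
    by (simp add: curl_def \<theta>_def case_prod_beta)
qed

lemma grad_curl_\<theta>: "grad (curl \<theta>) q = (0, 0)"
proof -
  have "curl \<theta> = (\<lambda>_. 2)" by (simp add: curl_\<theta> fun_eq_iff)
  then show ?thesis using grad_eqI[OF has_derivative_const[of "2::real"]] by simp
qed

lemma H_eq: "H \<alpha> \<beta> q p = (norm (p - \<theta> q))\<^sup>2 / 2 + V \<alpha> \<beta> q"
  by (cases q; cases p) (simp add: H_def \<theta>_def V_def norm_Pair)

lemma e0_eq_0: "\<alpha> > 0 \<Longrightarrow> \<beta> > 0 \<Longrightarrow> e0 \<alpha> \<beta> = 0"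
  unfolding e0_def
proof (rule antisym)
  assume "\<alpha> > 0" "\<beta> > 0"
  then have "- \<alpha> * x\<^sup>2 \<le> 0" "\<beta> * y\<^sup>2 \<ge> 0" for x y :: real by simp_all
  then have "V \<alpha> \<beta> q \<le> 0" for q
    unfolding V_def by (cases q) (smt (verit) case_prod_conv)
  then show "(SUP q. ereal (V \<alpha> \<beta> q)) \<le> 0" by (simp add: SUP_le_iff zero_ereal_def)
  show "0 \<le> (SUP q. ereal (V \<alpha> \<beta> q))"
    by (rule SUP_upper2[of "(0, 0)"]) (simp_all add: V_def zero_ereal_def)
qed

lemma em_field_eq:
  "em_field (V \<alpha> \<beta>) \<theta> ((x, y), (vx, vy)) =
     ((vx, vy), (2 * \<alpha> * x + 2 * vy, 2 * \<beta> * y - 2 * vx))"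
  by (simp add: em_field_def grad_V curl_\<theta> rot90_def)

lemma em_curvature_eq:
  assumes v: "((x, y), r *\<^sub>R (cos \<phi>, sin \<phi>)) \<in> energy_level (V \<alpha> \<beta>) e" and "r > 0"
  defines "W \<equiv> e + \<alpha> * x\<^sup>2 + \<beta> * y\<^sup>2"
  shows "em_curvature (V \<alpha> \<beta>) \<theta> e (x, y) (r *\<^sub>R (cos \<phi>, sin \<phi>)) =
    (2 - \<alpha> - \<beta>) / (2 * W\<^sup>2) + (\<alpha>\<^sup>2 * x\<^sup>2 + \<beta>\<^sup>2 * y\<^sup>2) / W ^ 3
      - sqrt 2 * (\<alpha> * x * sin \<phi> - \<beta> * y * cos \<phi>) / W powr (5 / 2)"
proof -
  have n: "norm (r *\<^sub>R (cos \<phi>, sin \<phi>)) = r"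
    using \<open>r > 0\<close> unfolding norm_scaleR norm_Pair by simp
  have "r\<^sup>2 / 2 = W" using v unfolding energy_level_def W_def
    by (simp add: V_def n[simplified])
  then have "W > 0" using \<open>r > 0\<close> by (metis half_gt_zero zero_less_power)
  have w: "e - V \<alpha> \<beta> (x, y) = W" by (simp add: V_def W_def)
  have u: "rot90 (r *\<^sub>R (cos \<phi>, sin \<phi>) /\<^sub>R norm (r *\<^sub>R (cos \<phi>, sin \<phi>))) = (- sin \<phi>, cos \<phi>)"
    unfolding n using \<open>r > 0\<close> by (simp add: rot90_def)
  have s: "(2::real) powr (5 / 2) = 4 * sqrt 2"
    using powr_add[of "2::real" 2 "1 / 2"] by (simp add: powr_half_sqrt)
  have p: "(2 * W) powr (5 / 2) = 4 * sqrt 2 * W powr (5 / 2)"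
    using \<open>W > 0\<close> by (simp add: powr_mult s)
  have k: "8 * z / (4 * sqrt 2 * t) = sqrt 2 * z / t" for z t :: real
    by (simp add: divide_simps)
  have "2 * 2 * inner (grad (V \<alpha> \<beta>) (x, y)) (- sin \<phi>, cos \<phi>) / (2 * W) powr (5 / 2)
      = 8 * (\<alpha> * x * sin \<phi> - \<beta> * y * cos \<phi>) / (4 * sqrt 2 * W powr (5 / 2))"
    unfolding p by (simp add: grad_V algebra_simps)
  note l = this[unfolded k]
  have m: "(norm (grad (V \<alpha> \<beta>) (x, y)))\<^sup>2 / (4 * W ^ 3) = (\<alpha>\<^sup>2 * x\<^sup>2 + \<beta>\<^sup>2 * y\<^sup>2) / W ^ 3"
    by (simp add: grad_V norm_Pair power_mult_distrib add_divide_distrib)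
  have q: "(- 2 * \<alpha> - 2 * \<beta>) / (4 * W\<^sup>2) + 2\<^sup>2 / (4 * W\<^sup>2) = (2 - \<alpha> - \<beta>) / (2 * W\<^sup>2)"
    using \<open>W > 0\<close> by (simp add: field_simps)
  show ?thesis
    unfolding em_curvature_def Let_def w u curl_\<theta> laplacian_V l m grad_curl_\<theta> q[symmetric]
    by simp
qed

text \<open>At \<alpha> = \<beta> = 1/2 the curvature condition holds, with empty boundary: the curvature is
  positive everywhere at every positive energy. But sqrt \<alpha> + sqrt \<beta> < sqrt 2 fails, so the
  curvature condition characterises stability only away from this point.\<close>

lemma positive_curvature_set_half:
  assumes "e > 0"
  shows "positive_curvature_set (V (1/2) (1/2)) \<theta> e = UNIV"
proof -
  have "em_curvature (V (1/2) (1/2)) \<theta> e (x, y) v > 0"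
    if v: "((x, y), v) \<in> energy_level (V (1/2) (1/2)) e" for x y v
  proof -
    define W where "W = e + 1/2 * x\<^sup>2 + 1/2 * y\<^sup>2"
    have "W > 0" using assms by (simp add: W_def add_pos_nonneg)
    have nv: "(norm v)\<^sup>2 / 2 = W"
      using v by (simp add: energy_level_def V_def W_def algebra_simps)
    then have "norm v > 0" using \<open>W > 0\<close> by auto
    have "(fst v / norm v)\<^sup>2 + (snd v / norm v)\<^sup>2 = (norm v)\<^sup>2 / (norm v)\<^sup>2"
      by (cases v) (simp add: norm_Pair power_divide flip: add_divide_distrib)
    then have "(fst v / norm v)\<^sup>2 + (snd v / norm v)\<^sup>2 = 1" using \<open>norm v > 0\<close> by simp
    then obtain \<phi> where \<phi>: "fst v / norm v = cos \<phi>" "snd v / norm v = sin \<phi>"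
      using sincos_total_2pi by metis
    have v_eq: "v = norm v *\<^sub>R (cos \<phi>, sin \<phi>)"
      using \<open>norm v > 0\<close> unfolding \<phi>[symmetric] by (simp add: prod_eq_iff)
    define D where "D = x * sin \<phi> - y * cos \<phi>"
    define R where "R = sqrt (x\<^sup>2 + y\<^sup>2)"
    define S where "S = sqrt W"
    have S: "S > 0" "S\<^sup>2 = W" using \<open>W > 0\<close> by (auto simp: S_def)
    have R: "R \<ge> 0" "R\<^sup>2 = x\<^sup>2 + y\<^sup>2" by (auto simp: R_def)
    have "(x * s - y * c)\<^sup>2 + (x * c + y * s)\<^sup>2 = (x\<^sup>2 + y\<^sup>2) * (s\<^sup>2 + c\<^sup>2)" for s c
      by (simp add: power2_eq_square algebra_simps)
    from this[of "sin \<phi>" "cos \<phi>"] have "D\<^sup>2 + (x * cos \<phi> + y * sin \<phi>)\<^sup>2 = (x\<^sup>2 + y\<^sup>2) * ((sin \<phi>)\<^sup>2 + (cos \<phi>)\<^sup>2)"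
      unfolding D_def .
    then have "D\<^sup>2 + (x * cos \<phi> + y * sin \<phi>)\<^sup>2 = R\<^sup>2" by (simp add: R(2))
    then have "D\<^sup>2 \<le> R\<^sup>2" by (metis le_add_same_cancel1 zero_le_power2)
    then have D: "D \<le> R" using R(1) by (rule power2_le_imp_le)
    have "R\<^sup>2 < (sqrt 2 * S)\<^sup>2" unfolding power_mult_distrib S(2) R(2)
      using assms by (simp add: W_def)
    then have RS: "R < sqrt 2 * S" using S by (simp add: power2_less_imp_less)
    have "W = S powr 2" using S by simp
    then have "W powr (5 / 2) = S powr 5" by (simp only: powr_powr) simp
    then have p: "W powr (5 / 2) = S ^ 5" using S(1) by simp
    have "em_curvature (V (1/2) (1/2)) \<theta> e (x, y) v =
        1 / (2 * W\<^sup>2) + R\<^sup>2 / 4 / W ^ 3 - sqrt 2 * (D / 2) / W powr (5 / 2)"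
    proof -
      have c: "em_curvature (V (1/2) (1/2)) \<theta> e (x, y) v =
          (2 - 1/2 - 1/2) / (2 * W\<^sup>2) + ((1/2)\<^sup>2 * x\<^sup>2 + (1/2)\<^sup>2 * y\<^sup>2) / W ^ 3
            - sqrt 2 * (1/2 * x * sin \<phi> - 1/2 * y * cos \<phi>) / W powr (5 / 2)"
        by (rule em_curvature_eq[of x y "norm v" \<phi> "1/2" "1/2" e, folded v_eq W_def,
              OF v \<open>norm v > 0\<close>])
      have f: "(1/2)\<^sup>2 * x\<^sup>2 + (1/2)\<^sup>2 * y\<^sup>2 = R\<^sup>2 / 4"
        "1/2 * x * sin \<phi> - 1/2 * y * cos \<phi> = D / 2"
        by (simp_all add: R(2) D_def power_divide add_divide_distrib diff_divide_distrib)
      show ?thesis unfolding c f by simp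
    qed
    also have "\<dots> = (2 * S\<^sup>2 + R\<^sup>2 - 2 * sqrt 2 * D * S) / (4 * S ^ 6)"
    proof -
      have "1 / (2 * (S\<^sup>2)\<^sup>2) + r / 4 / (S\<^sup>2) ^ 3 - t * (D / 2) / S ^ 5
          = (2 * S\<^sup>2 + r - 2 * t * D * S) / (4 * S ^ 6)" for r t :: real
        using S(1) by (simp add: divide_simps eval_nat_numeral)
      from this[of "R\<^sup>2" "sqrt 2"] show ?thesis unfolding p unfolding S(2) .
    qed
    also have "\<dots> > 0"
    proof -
      have "2 * sqrt 2 * D * S \<le> 2 * sqrt 2 * R * S" using D S by simp
      moreover have "(sqrt 2 * S - R)\<^sup>2 > 0" using RS by simp
      moreover have "(sqrt 2 * S - R)\<^sup>2 = 2 * S\<^sup>2 + R\<^sup>2 - 2 * sqrt 2 * R * S"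
        by (simp add: power2_diff power_mult_distrib)
      ultimately have "2 * S\<^sup>2 + R\<^sup>2 - 2 * sqrt 2 * D * S > 0"
        by linarith
      then show ?thesis using S(1) by simp
    qed
    finally show ?thesis .
  qed
  then show ?thesis by (auto simp: positive_curvature_set_def)
qed

lemma curvature_condition_half: "curvature_condition (1/2) (1/2)"
  by (simp add: curvature_condition_def positive_curvature_set_half Let_def
      connected_component_UNIV)

lemma not_sqrt_less_half: "\<not> sqrt (1/2) + sqrt (1/2) < sqrt 2"
  by (simp add: real_sqrt_divide field_simps)

end

theory Submission
  imports Defs
begin

text \<open>
  All the conditions reduce to one polynomial inequality. Squaring twice,
  sqrt \<alpha> + sqrt \<beta> < sqrt 2 says that \<alpha> + \<beta> < 2 and 4\<alpha>\<beta> < (2 - \<alpha> - \<beta>)^2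
  (\<open>sqrt_sum_less_sqrt2_iff\<close>).

  Stability. An eigenvalue k of L satisfies a quadratic equation in k^2 whose two roots have sum
  2\<alpha> + 2\<beta> - 4 and product 4\<alpha>\<beta>. All eigenvalues are imaginary iff both roots are real and
  nonpositive; the discriminant is then nonnegative. If it vanishes, a diagonalizable L would have
  scalar square, which it has not; if it is positive there are four different eigenvalues, and L is
  diagonalizable (\<open>linearly_stable_iff\<close>).

  Critical value. If the inequality fails, a multiple of xy is a subsolution of H = 0
  (\<open>mane_critical_value_nonpos\<close>). If it holds, the circulation of \<theta> along a suitable ellipse is
  larger than the action available at energy 0, and by some margin at a small positive energy;
  since the differential of a function has no circulation, no function can keep H below this energy
  (\<open>mane_critical_value_pos\<close>).

  Curvature. The least curvature over all directions at q is positive iff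
  (t - 1)^2 > \<alpha> + \<beta> - 1, where t = |grad V| / |v| (\<open>mem_positive_curvature_set_iff\<close>). The origin has
  t = 0, so it lies in the positive set iff \<alpha> + \<beta> < 2. If \<alpha> + \<beta> < 1 the set is the plane.
  Otherwise the component of the origin is t < 1 - sqrt (\<alpha> + \<beta> - 1), which is the quadratic
  region \<alpha>(\<alpha> - k)x^2 + \<beta>(\<beta> - k)y^2 < ke with 2k = (1 - sqrt (\<alpha> + \<beta> - 1))^2. Its boundary is
  a hyperbola when the two coefficients have opposite signs, and the product (\<alpha> - k)(\<beta> - k) is
  exactly a quarter of 4\<alpha>\<beta> - (2 - \<alpha> - \<beta>)^2 (\<open>curvature_threshold_identity\<close>). When it is
  nonnegative, both coefficients are nonnegative and the boundary is a nonempty ellipse or pair of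
  lines, except that both vanish at \<alpha> = \<beta> = 1/2.
\<close>

section \<open>The stability threshold as a polynomial inequality\<close>

lemma sqrt_sum_less_sqrt2_iff:
  fixes \<alpha> \<beta> :: real
  assumes "\<alpha> > 0" "\<beta> > 0"
  shows "sqrt \<alpha> + sqrt \<beta> < sqrt 2 \<longleftrightarrow> \<alpha> + \<beta> < 2 \<and> 4 * (\<alpha> * \<beta>) < (2 - \<alpha> - \<beta>)\<^sup>2"
proof -
  have "sqrt \<alpha> + sqrt \<beta> < sqrt 2 \<longleftrightarrow> (sqrt \<alpha> + sqrt \<beta>)\<^sup>2 < (sqrt 2)\<^sup>2"
    using assms by (metis add_nonneg_nonneg less_imp_le power2_less_imp_less power_strict_mono
        real_sqrt_ge_zero zero_le_numeral zero_less_numeral)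
  also have "(sqrt \<alpha> + sqrt \<beta>)\<^sup>2 = \<alpha> + \<beta> + 2 * sqrt (\<alpha> * \<beta>)"
    using assms by (simp add: power2_sum real_sqrt_mult)
  finally have 1: "sqrt \<alpha> + sqrt \<beta> < sqrt 2 \<longleftrightarrow> 2 * sqrt (\<alpha> * \<beta>) < 2 - \<alpha> - \<beta>"
    by auto
  have p: "sqrt (\<alpha> * \<beta>) > 0" using assms by simp
  have 2: "4 * (\<alpha> * \<beta>) = (2 * sqrt (\<alpha> * \<beta>))\<^sup>2"
    using assms by (simp add: power_mult_distrib)
  show ?thesis unfolding 1 2
    using p by (smt (verit) power2_less_imp_less power_strict_mono zero_less_numeral)
qed

section \<open>Linear stability\<close>

lemma diagonalizableI:
  assumes "A \<in> carrier_mat n n" "P \<in> carrier_mat n n" "Q \<in> carrier_mat n n" "D \<in> carrier_mat n n"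
    and D: "diagonal_mat D" and QP: "Q * P = 1\<^sub>m n" and AP: "A * P = P * D"
  shows "diagonalizable A"
proof -
  have PQ: "P * Q = 1\<^sub>m n" using mat_mult_left_right_inverse[OF assms(3,2) QP] .
  have "A = A * (P * Q)" using assms by (simp add: PQ)
  also have "\<dots> = P * D * Q" using assms by (metis AP assoc_mult_mat)
  finally have "similar_mat A D"
    using assms PQ by (intro similar_matI[where P = P and Q = Q and n = n]) auto
  with D show ?thesis unfolding diagonalizable_def by blast
qed

text \<open>In a diagonal form D of A the square of each entry is m, so D has scalar square, and a scalar
  matrix is its own conjugate. For L with a double root m this is the obstruction to
  diagonalizability.\<close>

lemma diagonalizable_square_eq_smult_one:
  assumes A: "A \<in> carrier_mat n n" and "diagonalizable A"
    and sq: "\<And>k. eigenvalue A k \<Longrightarrow> k\<^sup>2 = m"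
  shows "A * A = m \<cdot>\<^sub>m 1\<^sub>m n"
proof -
  obtain D where D: "diagonal_mat D" and sim: "similar_mat A D"
    using assms unfolding diagonalizable_def by blast
  then obtain P Q where wit: "similar_mat_wit A D P Q" unfolding similar_mat_def by blast
  note w = similar_mat_witD2[OF A wit]
  have "char_poly A = char_poly D" by (rule char_poly_similar[OF sim])
  also have "\<dots> = (\<Prod>a\<leftarrow>diag_mat D. [:- a, 1:])"
    using w D by (intro char_poly_upper_triangular[of _ n])
      (auto simp: diagonal_mat_def upper_triangular_def)
  finally have cp: "char_poly A = (\<Prod>a\<leftarrow>diag_mat D. [:- a, 1:])" .
  have entry: "(D $$ (i, i))\<^sup>2 = m" if "i < n" for i
  proof (rule sq, unfold eigenvalue_root_char_poly[OF A] cp)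
    show "poly (\<Prod>a\<leftarrow>diag_mat D. [:- a, 1:]) (D $$ (i, i)) = 0"
      unfolding poly_prod_list_zero_iff using that w by (auto simp: diag_mat_def)
  qed
  have "D * D = m \<cdot>\<^sub>m 1\<^sub>m n"
  proof (rule eq_matI)
    fix i j assume "i < dim_row (m \<cdot>\<^sub>m 1\<^sub>m n)" "j < dim_col (m \<cdot>\<^sub>m 1\<^sub>m n)"
    then have ij: "i < n" "j < n" by auto
    have "(D * D) $$ (i, j) = (\<Sum>k = 0..<n. D $$ (i, k) * D $$ (k, j))"
      using ij w by (simp add: scalar_prod_def)
    also have "\<dots> = (\<Sum>k = 0..<n. if k = i then D $$ (i, i) * D $$ (i, j) else 0)"
      using ij w D by (intro sum.cong) (auto simp: diagonal_mat_def)
    also have "\<dots> = D $$ (i, i) * D $$ (i, j)" using ij by simp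
    also have "\<dots> = (m \<cdot>\<^sub>m 1\<^sub>m n) $$ (i, j)"
      using ij w D entry[of i] by (cases "i = j") (auto simp: diagonal_mat_def power2_eq_square)
    finally show "(D * D) $$ (i, j) = (m \<cdot>\<^sub>m 1\<^sub>m n) $$ (i, j)" .
  qed (use w in auto)
  moreover have "A * A = P * (D * D) * Q"
  proof -
    have car: "P \<in> carrier_mat n n" "D \<in> carrier_mat n n" "Q \<in> carrier_mat n n"
      and QP: "Q * P = 1\<^sub>m n" and A_eq: "A = P * D * Q"
      using w by auto
    have "A * A = P * (D * ((Q * P) * (D * Q)))"
      unfolding A_eq using car by (simp add: assoc_mult_mat[of _ n n _ n _ n])
    also have "\<dots> = P * (D * D) * Q"
      unfolding QP using car by (simp add: assoc_mult_mat[of _ n n _ n _ n])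
    finally show ?thesis .
  qed
  ultimately show ?thesis
    using w by (simp add: mult_smult_distrib[of _ n n _ n] mult_smult_assoc_mat[of _ n n _ n])
qed

lemma L_carrier: "L \<alpha> \<beta> \<in> carrier_mat 4 4"
  unfolding L_def mat_of_rows_list_def by (intro carrier_matI) simp_all

lemma L_index:
  "i < 4 \<Longrightarrow> j < 4 \<Longrightarrow> L \<alpha> \<beta> $$ (i, j) =
    [[0, 0, 1, 0], [0, 0, 0, 1], [2 * of_real \<alpha>, 0, 0, 2], [0, 2 * of_real \<beta>, - 2, 0]] ! i ! j"
  unfolding L_def mat_of_rows_list_def by simp

lemma less_4_cases: "i < (4::nat) \<longleftrightarrow> i = 0 \<or> i = 1 \<or> i = 2 \<or> i = 3"
  by auto

lemma all_less_4: "(\<forall>i < (4::nat). Q i) \<longleftrightarrow> Q 0 \<and> Q 1 \<and> Q 2 \<and> Q 3"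
  by (simp add: eval_nat_numeral All_less_Suc conj_ac)

lemma sum_lessThan_4: "sum f {0..<4::nat} = f 0 + f 1 + f 2 + f 3"
  by (simp add: eval_nat_numeral)

lemma L_mult_vec_eq_iff:
  assumes v: "v \<in> carrier_vec 4"
  shows "L \<alpha> \<beta> *\<^sub>v v = k \<cdot>\<^sub>v v \<longleftrightarrow>
    vec_index v 2 = k * vec_index v 0 \<and> vec_index v 3 = k * vec_index v 1 \<and>
    2 * of_real \<alpha> * vec_index v 0 + 2 * vec_index v 3 = k * vec_index v 2 \<and>
    2 * of_real \<beta> * vec_index v 1 - 2 * vec_index v 2 = k * vec_index v 3"
proof -
  have d: "dim_row (L \<alpha> \<beta>) = 4" "dim_col (L \<alpha> \<beta>) = 4" "dim_vec v = 4"
    using v L_carrier[of \<alpha> \<beta>] by auto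
  have "L \<alpha> \<beta> *\<^sub>v v = k \<cdot>\<^sub>v v \<longleftrightarrow> (\<forall>i < 4. vec_index (L \<alpha> \<beta> *\<^sub>v v) i = vec_index (k \<cdot>\<^sub>v v) i)"
    unfolding vec_eq_iff using d by simp
  also have "\<dots> \<longleftrightarrow> (\<forall>i < 4. (\<Sum>j = 0..<4. L \<alpha> \<beta> $$ (i, j) * vec_index v j) = k * vec_index v i)"
    using d by (simp add: scalar_prod_def)
  finally show ?thesis
    unfolding all_less_4 sum_lessThan_4 by (simp add: L_index)
qed

text \<open>An eigenvector is determined by its position part (x, y), its velocity part being k(x, y);
  what remains is a 2 by 2 system whose determinant is the quartic below.\<close>

lemma eigenvalue_L_iff:
  assumes "\<alpha> > 0" "\<beta> > 0"
  shows "eigenvalue (L \<alpha> \<beta>) k \<longleftrightarrow>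
    (k\<^sup>2 - 2 * of_real \<alpha>) * (k\<^sup>2 - 2 * of_real \<beta>) + 4 * k\<^sup>2 = 0" (is "_ \<longleftrightarrow> ?p = 0")
proof
  assume "eigenvalue (L \<alpha> \<beta>) k"
  then obtain v where v: "v \<in> carrier_vec 4" "v \<noteq> 0\<^sub>v 4" "L \<alpha> \<beta> *\<^sub>v v = k \<cdot>\<^sub>v v"
    using L_carrier[of \<alpha> \<beta>] unfolding eigenvalue_def eigenvector_def by auto
  define x y where "x = vec_index v 0" and "y = vec_index v 1"
  from v(3) have eq: "vec_index v 2 = k * x" "vec_index v 3 = k * y"
    "2 * of_real \<alpha> * x + 2 * (k * y) = k * (k * x)" "2 * of_real \<beta> * y - 2 * (k * x) = k * (k * y)"
    unfolding L_mult_vec_eq_iff[OF v(1)] x_def y_def by metis+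
  have "?p * x = 0" "?p * y = 0" using eq(3,4) by Groebner_Basis.algebra+
  moreover have "x \<noteq> 0 \<or> y \<noteq> 0"
  proof (rule ccontr)
    assume "\<not> ?thesis"
    then have "vec_index v i = 0" if "i < 4" for i
      using that eq unfolding less_4_cases x_def y_def by auto
    then have "v = 0\<^sub>v 4" using v(1) by (intro eq_vecI) auto
    with v(2) show False ..
  qed
  ultimately show "?p = 0" by auto
next
  assume p: "?p = 0"
  have "k \<noteq> 0"
  proof
    assume "k = 0"
    with p have "complex_of_real (4 * (\<alpha> * \<beta>)) = 0" by simp
    then show False using assms by (simp del: of_real_mult)
  qed
  define v where "v = Matrix.vec 4 (\<lambda>i. [2 * k, k\<^sup>2 - 2 * of_real \<alpha>, 2 * k\<^sup>2, k * (k\<^sup>2 - 2 * of_real \<alpha>)] ! i)"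
  have v: "v \<in> carrier_vec 4" "vec_index v 0 = 2 * k" "vec_index v 1 = k\<^sup>2 - 2 * of_real \<alpha>"
    "vec_index v 2 = 2 * k\<^sup>2" "vec_index v 3 = k * (k\<^sup>2 - 2 * of_real \<alpha>)"
    by (simp_all add: v_def)
  have "L \<alpha> \<beta> *\<^sub>v v = k \<cdot>\<^sub>v v"
    unfolding L_mult_vec_eq_iff[OF v(1)] v(2-)
    by (intro conjI) (use p in Groebner_Basis.algebra)+
  moreover have "v \<noteq> 0\<^sub>v 4" using v(2) \<open>k \<noteq> 0\<close> by auto
  ultimately show "eigenvalue (L \<alpha> \<beta>) k"
    using v(1) L_carrier[of \<alpha> \<beta>] unfolding eigenvalue_def eigenvector_def by auto
qed

lemma L_square_not_scalar: "L \<alpha> \<beta> * L \<alpha> \<beta> \<noteq> m \<cdot>\<^sub>m 1\<^sub>m 4"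
proof
  assume eq: "L \<alpha> \<beta> * L \<alpha> \<beta> = m \<cdot>\<^sub>m 1\<^sub>m 4"
  have "(L \<alpha> \<beta> * L \<alpha> \<beta>) $$ (0, 3) = (\<Sum>k = 0..<4. L \<alpha> \<beta> $$ (0, k) * L \<alpha> \<beta> $$ (k, 3))"
    using L_carrier[of \<alpha> \<beta>] by (simp add: scalar_prod_def)
  also have "\<dots> = 2" unfolding sum_lessThan_4 by (simp add: L_index)
  finally show False unfolding eq by simp
qed

text \<open>The quartic of the eigenvalues, factored by the two values m1 and m2 of the square of an
  eigenvalue.\<close>

lemma eigenvalue_equation_factors:
  fixes m1 m2 k :: complex
  assumes "m1 + m2 = of_real (2 * \<alpha> + 2 * \<beta> - 4)" "m1 * m2 = of_real (4 * (\<alpha> * \<beta>))"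
  shows "(k\<^sup>2 - 2 * of_real \<alpha>) * (k\<^sup>2 - 2 * of_real \<beta>) + 4 * k\<^sup>2 = (k\<^sup>2 - m1) * (k\<^sup>2 - m2)"
proof -
  have "(k\<^sup>2 - m1) * (k\<^sup>2 - m2) = k\<^sup>2 * k\<^sup>2 - (m1 + m2) * k\<^sup>2 + m1 * m2"
    by (simp add: algebra_simps)
  then show ?thesis unfolding assms by (simp add: algebra_simps)
qed

text \<open>The four eigenvalues are the square roots of m1 and of m2, hence different. Right and left
  eigenvectors for different eigenvalues are orthogonal, so the matrix of left eigenvectors is,
  after normalisation, the inverse of the matrix of right eigenvectors. The normalisation is
  possible because a right eigenvector orthogonal to the left one of the same eigenvalue k forces
  k^4 = 4\<alpha>\<beta> = m1 m2, that is m1 = m2.\<close>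

lemma diagonalizable_L:
  assumes p: "\<alpha> > 0" "\<beta> > 0"
    and roots: "m1 + m2 = complex_of_real (2 * \<alpha> + 2 * \<beta> - 4)"
      "m1 * m2 = complex_of_real (4 * (\<alpha> * \<beta>))"
    and ne: "m1 \<noteq> m2"
  shows "diagonalizable (L \<alpha> \<beta>)"
proof -
  define a b where "a = complex_of_real \<alpha>" and "b = complex_of_real \<beta>"
  have ab: "a \<noteq> 0" "b \<noteq> 0" using p by (auto simp: a_def b_def)
  have m: "m1 + m2 = 2 * a + 2 * b - 4" "m1 * m2 = 4 * (a * b)"
    using roots by (auto simp: a_def b_def)
  then have m0: "m1 \<noteq> 0" "m2 \<noteq> 0" using ab by auto
  define z where "z = (\<lambda>j. [csqrt m1, - csqrt m1, csqrt m2, - csqrt m2] ! j)"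
  have zsq: "(z j)\<^sup>2 = (if j < 2 then m1 else m2)" if "j < 4" for j
    using that unfolding less_4_cases z_def by auto
  have z0: "z j \<noteq> 0" if "j < 4" for j using zsq[OF that] m0 by (auto split: if_splits)
  have inj: "z i \<noteq> z j" if "i < 4" "j < 4" "i \<noteq> j" for i j
  proof
    assume e: "z i = z j"
    have "m1 = m2 \<or> z i = - z j"
      using zsq[OF that(1)] zsq[OF that(2)] that e
      unfolding less_4_cases z_def by (auto split: if_splits)
    then show False using ne e z0[OF that(2)] by auto
  qed
  have quartic: "((z j)\<^sup>2 - 2 * a) * ((z j)\<^sup>2 - 2 * b) + 4 * (z j)\<^sup>2 = 0" if "j < 4" for j
    unfolding a_def b_def eigenvalue_equation_factors[OF roots] using zsq[OF that] by auto
  \<comment> \<open>Right and left eigenvectors of L for the eigenvalue x.\<close>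
  define R where "R = (\<lambda>x. [2 * x, x\<^sup>2 - 2 * a, 2 * x\<^sup>2, x * (x\<^sup>2 - 2 * a)])"
  define E where "E = (\<lambda>x. [4 * a, 2 * a * x - x ^ 3 - 4 * x, 2 * x, 2 * a - x\<^sup>2])"
  define pair where "pair = (\<lambda>x y. \<Sum>k = 0..<4. E x ! k * R y ! k)"
  have pair: "pair x y = 8 * a * y + (2 * a * x - x ^ 3 - 4 * x) * (y\<^sup>2 - 2 * a) + 4 * x * y\<^sup>2
      + (2 * a - x\<^sup>2) * (y * (y\<^sup>2 - 2 * a))" for x y
    unfolding pair_def sum_lessThan_4 by (simp add: E_def R_def)
  have orth: "pair (z i) (z j) = 0" if "i < 4" "j < 4" "i \<noteq> j" for i j
  proof -
    have "(z i - z j) * pair (z i) (z j) = 0"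
      unfolding pair using quartic[OF that(1)] quartic[OF that(2)] by Groebner_Basis.algebra
    then show ?thesis using inj[OF that] by simp
  qed
  have nonzero: "pair (z i) (z i) \<noteq> 0" if i: "i < 4" for i
  proof
    assume "pair (z i) (z i) = 0"
    then have "2 * z i * (8 * a - ((z i)\<^sup>2 - 2 * a)\<^sup>2) = 0"
      unfolding pair by Groebner_Basis.algebra
    then have "((z i)\<^sup>2 - 2 * a)\<^sup>2 = 8 * a" using z0[OF i] by simp
    then have "4 * a * (((z i)\<^sup>2)\<^sup>2 - m1 * m2) = 0"
      using quartic[OF i] m by Groebner_Basis.algebra
    then have "((z i)\<^sup>2)\<^sup>2 = m1 * m2" using ab by simp
    then show False
      using zsq[OF i] m0 ne by (auto simp: power2_eq_square split: if_splits)
  qed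
  define P where "P = mat 4 4 (\<lambda>(i, j). R (z j) ! i)"
  define Q where "Q = mat 4 4 (\<lambda>(i, j). E (z i) ! j / pair (z i) (z i))"
  define D where "D = mat 4 4 (\<lambda>(i, j). if i = j then z i else 0)"
  show ?thesis
  proof (rule diagonalizableI)
    show "L \<alpha> \<beta> \<in> carrier_mat 4 4" by (rule L_carrier)
    show "P \<in> carrier_mat 4 4" "Q \<in> carrier_mat 4 4" "D \<in> carrier_mat 4 4"
      by (auto simp: P_def Q_def D_def)
    show "diagonal_mat D" by (auto simp: diagonal_mat_def D_def)
    show "Q * P = 1\<^sub>m 4"
    proof (rule eq_matI)
      fix i j assume "i < dim_row (1\<^sub>m 4 :: complex mat)" "j < dim_col (1\<^sub>m 4 :: complex mat)"
      then have ij: "i < 4" "j < 4" by auto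
      have "(Q * P) $$ (i, j) = (\<Sum>k = 0..<4. E (z i) ! k / pair (z i) (z i) * R (z j) ! k)"
        using ij by (simp add: Q_def P_def scalar_prod_def)
      also have "\<dots> = pair (z i) (z j) / pair (z i) (z i)"
        by (simp add: pair_def sum_divide_distrib)
      also have "\<dots> = (1\<^sub>m 4) $$ (i, j)" using ij orth nonzero by auto
      finally show "(Q * P) $$ (i, j) = 1\<^sub>m 4 $$ (i, j)" .
    qed (auto simp: Q_def P_def)
    show "L \<alpha> \<beta> * P = P * D"
    proof (rule eq_matI)
      fix i j assume "i < dim_row (P * D)" "j < dim_col (P * D)"
      then have ij: "i < 4" "j < 4" by (auto simp: P_def D_def)
      have "(P * D) $$ (i, j) = (\<Sum>k = 0..<4. R (z k) ! i * (if k = j then z k else 0))"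
        using ij by (simp add: D_def P_def scalar_prod_def)
      also have "\<dots> = (\<Sum>k = 0..<4. if k = j then R (z j) ! i * z j else 0)"
        by (intro sum.cong) auto
      also have "\<dots> = R (z j) ! i * z j"
        using ij by simp
      also have "\<dots> = (\<Sum>k = 0..<4. L \<alpha> \<beta> $$ (i, k) * R (z j) ! k)"
      proof -
        have "z j * ((z j)\<^sup>2 - 2 * a) * z j = 2 * b * ((z j)\<^sup>2 - 2 * a) - 4 * (z j)\<^sup>2"
          using quartic[OF ij(2)] by Groebner_Basis.algebra
        then show ?thesis
          using ij(1) unfolding less_4_cases sum_lessThan_4
          by (elim disjE) (simp_all add: L_index R_def a_def[symmetric] b_def[symmetric]
              power2_eq_square algebra_simps)
      qed
      also have "\<dots> = (L \<alpha> \<beta> * P) $$ (i, j)"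
        using ij L_carrier[of \<alpha> \<beta>] by (simp add: P_def scalar_prod_def)
      finally show "(L \<alpha> \<beta> * P) $$ (i, j) = (P * D) $$ (i, j)" ..
    qed (use L_carrier[of \<alpha> \<beta>] in \<open>auto simp: P_def D_def\<close>)
  qed
qed

text \<open>Every root m of the quadratic in k^2 has an eigenvalue \<open>csqrt m\<close> above it; so all eigenvalues
  are imaginary only if both roots are real and nonpositive. Their squared difference is four times
  (2 - \<alpha> - \<beta>)^2 - 4\<alpha>\<beta>.\<close>

lemma linearly_stable_iff:
  assumes p: "\<alpha> > 0" "\<beta> > 0"
  shows "linearly_stable_equilibrium \<alpha> \<beta> (0, 0) \<longleftrightarrow> sqrt \<alpha> + sqrt \<beta> < sqrt 2"
proof -
  have eq: "em_field (V \<alpha> \<beta>) \<theta> ((0, 0), 0) = 0"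
    using em_field_eq[of \<alpha> \<beta> 0 0 0 0] by (simp add: zero_prod_def)
  show ?thesis
  proof
    assume st: "linearly_stable_equilibrium \<alpha> \<beta> (0, 0)"
    define d where "d = csqrt (of_real ((\<alpha> + \<beta> - 2)\<^sup>2 - 4 * (\<alpha> * \<beta>)))"
    define m1 m2 where "m1 = of_real (\<alpha> + \<beta> - 2) + d" and "m2 = of_real (\<alpha> + \<beta> - 2) - d"
    have d2: "d * d = of_real ((\<alpha> + \<beta> - 2)\<^sup>2 - 4 * (\<alpha> * \<beta>))"
      unfolding d_def power2_eq_square[symmetric] by (rule power2_csqrt)
    have m: "m1 + m2 = of_real (2 * \<alpha> + 2 * \<beta> - 4)" "m1 * m2 = of_real (4 * (\<alpha> * \<beta>))"
      unfolding m1_def m2_def using d2[simplified] by (simp, simp, Groebner_Basis.algebra)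
    have "\<exists>r \<ge> 0. k = - complex_of_real r" if "k = m1 \<or> k = m2" for k
    proof -
      define m where "m = Im (csqrt k)"
      have "eigenvalue (L \<alpha> \<beta>) (csqrt k)"
        unfolding eigenvalue_L_iff[OF p] eigenvalue_equation_factors[OF m] using that by auto
      then have "Re (csqrt k) = 0" using st unfolding linearly_stable_equilibrium_def by blast
      then have im: "csqrt k = \<i> * of_real m" by (simp add: complex_eq_iff m_def)
      have "k = (csqrt k)\<^sup>2" by simp
      also have "\<dots> = - of_real (m\<^sup>2)" unfolding im by (simp add: power_mult_distrib)
      finally have "k = - complex_of_real (m\<^sup>2)" .
      then show ?thesis using zero_le_power2 by blast
    qed
    from this[of m1] this[of m2] obtain r1 r2 where r: "r1 \<ge> 0" "r2 \<ge> 0" "m1 = - complex_of_real r1" "m2 = - complex_of_real r2"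
      by auto
    have "complex_of_real (- r1 - r2) = of_real (2 * \<alpha> + 2 * \<beta> - 4)"
      "complex_of_real (r1 * r2) = of_real (4 * (\<alpha> * \<beta>))"
      using m unfolding r by simp_all
    then have rs: "r1 + r2 = 4 - 2 * \<alpha> - 2 * \<beta>" "r1 * r2 = 4 * (\<alpha> * \<beta>)"
      unfolding of_real_eq_iff by auto
    have "m1 \<noteq> m2"
    proof
      assume "m1 = m2"
      then have "k\<^sup>2 = m1" if "eigenvalue (L \<alpha> \<beta>) k" for k
        using that unfolding eigenvalue_L_iff[OF p] eigenvalue_equation_factors[OF m] by auto
      then have "L \<alpha> \<beta> * L \<alpha> \<beta> = m1 \<cdot>\<^sub>m 1\<^sub>m 4"
        using st unfolding linearly_stable_equilibrium_def
        by (intro diagonalizable_square_eq_smult_one[OF L_carrier]) auto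
      then show False using L_square_not_scalar by blast
    qed
    then have "(r1 - r2)\<^sup>2 > 0" using r by auto
    moreover have "(r1 - r2)\<^sup>2 = (r1 + r2)\<^sup>2 - 4 * (r1 * r2)"
      by (simp add: power2_eq_square algebra_simps)
    moreover have "(4 - 2 * \<alpha> - 2 * \<beta>)\<^sup>2 = 4 * (2 - \<alpha> - \<beta>)\<^sup>2"
      by (simp add: power2_eq_square algebra_simps)
    ultimately have lt: "4 * (\<alpha> * \<beta>) < (2 - \<alpha> - \<beta>)\<^sup>2" unfolding rs by linarith
    moreover have "\<alpha> + \<beta> \<noteq> 2"
    proof
      assume "\<alpha> + \<beta> = 2"
      then have "2 - \<alpha> - \<beta> = 0" by simp
      then have "4 * (\<alpha> * \<beta>) < 0" using lt by simp
      then show False using p by (simp add: mult_less_0_iff)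
    qed
    ultimately show "sqrt \<alpha> + sqrt \<beta> < sqrt 2"
      unfolding sqrt_sum_less_sqrt2_iff[OF p] using r rs by linarith
  next
    assume "sqrt \<alpha> + sqrt \<beta> < sqrt 2"
    then have lt: "\<alpha> + \<beta> < 2" "4 * (\<alpha> * \<beta>) < (2 - \<alpha> - \<beta>)\<^sup>2"
      unfolding sqrt_sum_less_sqrt2_iff[OF p] by auto
    define d where "d = sqrt ((2 - \<alpha> - \<beta>)\<^sup>2 - 4 * (\<alpha> * \<beta>))"
    have d: "d > 0" "d\<^sup>2 = (2 - \<alpha> - \<beta>)\<^sup>2 - 4 * (\<alpha> * \<beta>)" using lt by (auto simp: d_def)
    have "d\<^sup>2 < (2 - \<alpha> - \<beta>)\<^sup>2" unfolding d using p by simp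
    then have dl: "d < 2 - \<alpha> - \<beta>"
      by (rule power2_less_imp_less) (use lt(1) in simp)
    define m1 m2 where "m1 = complex_of_real (d - (2 - \<alpha> - \<beta>))"
      and "m2 = complex_of_real (- d - (2 - \<alpha> - \<beta>))"
    have "(d - (2 - \<alpha> - \<beta>)) * (- d - (2 - \<alpha> - \<beta>)) = 4 * (\<alpha> * \<beta>)"
      using d(2) by Groebner_Basis.algebra
    then have m: "m1 + m2 = of_real (2 * \<alpha> + 2 * \<beta> - 4)" "m1 * m2 = of_real (4 * (\<alpha> * \<beta>))"
      unfolding m1_def m2_def of_real_mult[symmetric] of_real_add[symmetric] by simp_all
    have "m1 \<noteq> m2" using d by (auto simp: m1_def m2_def simp del: of_real_diff of_real_add)
    then have dg: "diagonalizable (L \<alpha> \<beta>)" using diagonalizable_L[OF p m] by blast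
    have "Re k = 0" if "eigenvalue (L \<alpha> \<beta>) k" for k
    proof -
      have "k\<^sup>2 = m1 \<or> k\<^sup>2 = m2"
        using that unfolding eigenvalue_L_iff[OF p] eigenvalue_equation_factors[OF m] by auto
      moreover have "d - (2 - \<alpha> - \<beta>) < 0" "- d - (2 - \<alpha> - \<beta>) < 0" using d dl lt by auto
      ultimately obtain r where r: "k\<^sup>2 = complex_of_real r" "r < 0"
        unfolding m1_def m2_def by blast
      have "Re k * Im k = 0" "(Re k)\<^sup>2 - (Im k)\<^sup>2 = r"
        using r(1) by (auto simp: complex_eq_iff power2_eq_square)
      then show ?thesis using r(2) by (smt (verit) mult_eq_0_iff zero_eq_power2 zero_le_power2)
    qed
    with eq dg show "linearly_stable_equilibrium \<alpha> \<beta> (0, 0)"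
      unfolding linearly_stable_equilibrium_def by blast
  qed
qed

section \<open>The critical value\<close>

text \<open>The directional derivatives stay in the class of functions a + bx + cy + dxy, which carries
  the induction on the order of differentiability.\<close>

lemma bilinear_in_C_infinity:
  "(\<lambda>q. a + b * fst q + c * snd q + d * (fst q * snd q)) \<in> C_infinity"
proof -
  have der: "((\<lambda>q. a + b * fst q + c * snd q + d * (fst q * snd q)) has_derivative
      (\<lambda>w. b * fst w + c * snd w + d * (fst q * snd w + fst w * snd q))) (at q)"
    for a b c d and q :: "real \<times> real"
    by (auto intro!: derivative_eq_intros)
  have "C_k k (\<lambda>q. a + b * fst q + c * snd q + d * (fst q * snd q))" for k
  proof (induction k arbitrary: a b c d)
    case 0
    show ?case by (auto intro!: continuous_intros)
  next
    case (Suc k)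
    have "(\<lambda>q. frechet_derivative (\<lambda>q. a + b * fst q + c * snd q + d * (fst q * snd q)) (at q) w) =
        (\<lambda>q. (b * fst w + c * snd w) + d * snd w * fst q + d * fst w * snd q + 0 * (fst q * snd q))"
      for w :: "real \<times> real"
      unfolding frechet_derivative_at[OF der, symmetric] by (auto simp: algebra_simps)
    then have "C_k k (\<lambda>q. frechet_derivative
        (\<lambda>q. a + b * fst q + c * snd q + d * (fst q * snd q)) (at q) w)" for w
      using Suc.IH by presburger
    then show ?case
      unfolding C_k.simps differentiable_def using der by blast
  qed
  then show ?thesis by (simp add: C_infinity_def)
qed

text \<open>For f = (1 - a)xy the energy H(q, df(q)) is diagonal with coefficients a^2/2 - \<alpha> and
  (2 - a)^2/2 - \<beta>. Some a makes both nonpositive precisely when sqrt (2\<alpha>) + sqrt (2\<beta>) is at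
  least 2.\<close>

lemma mane_critical_value_nonpos:
  assumes p: "\<alpha> > 0" "\<beta> > 0" and ge: "sqrt \<alpha> + sqrt \<beta> \<ge> sqrt 2"
  shows "mane_critical_value (H \<alpha> \<beta>) \<le> 0"
proof -
  define a where "a = min 2 (sqrt (2 * \<alpha>))"
  have "sqrt (2 * \<alpha>) + sqrt (2 * \<beta>) = sqrt 2 * (sqrt \<alpha> + sqrt \<beta>)"
    by (simp add: real_sqrt_mult algebra_simps)
  also have "\<dots> \<ge> sqrt 2 * sqrt 2" using ge by (intro mult_left_mono) auto
  finally have s: "sqrt (2 * \<alpha>) + sqrt (2 * \<beta>) \<ge> 2" by simp
  have a: "0 \<le> a" "a \<le> sqrt (2 * \<alpha>)" "0 \<le> 2 - a" "2 - a \<le> sqrt (2 * \<beta>)"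
    using s p real_sqrt_ge_zero[of "2 * \<beta>"] by (auto simp: a_def min_def)
  have a2: "a\<^sup>2 \<le> 2 * \<alpha>" "(2 - a)\<^sup>2 \<le> 2 * \<beta>"
    using power_mono[OF a(2) a(1), of 2] power_mono[OF a(4) a(3), of 2] p by auto
  define f where "f = (\<lambda>q::real \<times> real. (1 - a) * (fst q * snd q))"
  have "f = (\<lambda>q. 0 + 0 * fst q + 0 * snd q + (1 - a) * (fst q * snd q))"
    by (simp add: f_def)
  then have f: "f \<in> C_infinity" using bilinear_in_C_infinity by metis
  have "(f has_derivative (\<lambda>w. (1 - a) * (fst q * snd w + fst w * snd q))) (at q)" for q
    unfolding f_def by (auto intro!: derivative_eq_intros)
  from grad_eqI[OF this] have grad: "grad f (x, y) = ((1 - a) * y, (1 - a) * x)" for x y by simp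
  have "H \<alpha> \<beta> (x, y) (grad f (x, y)) \<le> 0" for x y
  proof -
    have "H \<alpha> \<beta> (x, y) (grad f (x, y)) = (2 - a)\<^sup>2 * y\<^sup>2 / 2 + a\<^sup>2 * x\<^sup>2 / 2 - \<alpha> * x\<^sup>2 - \<beta> * y\<^sup>2"
      unfolding grad H_def by (simp add: power2_eq_square field_simps)
    moreover have "a\<^sup>2 * x\<^sup>2 \<le> 2 * \<alpha> * x\<^sup>2" "(2 - a)\<^sup>2 * y\<^sup>2 \<le> 2 * \<beta> * y\<^sup>2"
      using a2 by (auto intro: mult_right_mono)
    ultimately show ?thesis by linarith
  qed
  then have "(SUP q. ereal (H \<alpha> \<beta> q (grad f q))) \<le> 0"
    by (auto simp: SUP_le_iff zero_ereal_def)
  then show ?thesis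
    unfolding mane_critical_value_def using f by (meson INF_lower2)
qed

text \<open>Suppose that H(q, df(q)) \<le> \<delta> everywhere, and let c run once through the ellipse with
  semiaxes \<beta>^(1/4) and \<alpha>^(1/4). Writing df = \<theta> + p, the derivative of f along c is \<theta>(c') + p(c').
  Here \<theta>(c') is constant and equal to the product of the semiaxes, while
  |p|^2 \<le> 2(\<delta> - V) and hence 2|p(c')| \<le> 2(\<delta> - V)/\<kappa> + \<kappa>|c'|^2 for every \<kappa> > 0. The semiaxes are
  chosen to make -2V proportional to |c'|^2 along c, with factor \<kappa>^2 = 2 sqrt (\<alpha>\<beta>), so that at
  \<delta> = 0 nothing is lost in the last inequality. The mean of the resulting lower bound for the derivative
  of f along c is \<gamma> - \<delta>/\<kappa>, where \<gamma> > 0 says that sqrt \<alpha> + sqrt \<beta> < sqrt 2. For small \<delta> the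
  function f would increase around a closed curve.\<close>

lemma mane_critical_value_pos:
  assumes p: "\<alpha> > 0" "\<beta> > 0" and lt: "sqrt \<alpha> + sqrt \<beta> < sqrt 2"
  shows "mane_critical_value (H \<alpha> \<beta>) > 0"
proof -
  define s r where "s = sqrt \<alpha>" and "r = sqrt \<beta>"
  define a b where "a = sqrt r" and "b = sqrt s"
  have pos: "s > 0" "r > 0" "a > 0" "b > 0"
    using p by (auto simp: s_def r_def a_def b_def)
  have sq: "s\<^sup>2 = \<alpha>" "r\<^sup>2 = \<beta>" "a\<^sup>2 = r" "b\<^sup>2 = s"
    using pos p by (auto simp: s_def r_def a_def b_def)
  define \<kappa> where "\<kappa> = sqrt 2 * (a * b)"
  have \<kappa>: "\<kappa> > 0" using pos by (simp add: \<kappa>_def)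
  have \<kappa>2: "\<kappa>\<^sup>2 = 2 * (s * r)" by (simp add: \<kappa>_def power_mult_distrib sq)
  define \<gamma> where "\<gamma> = a * b - \<kappa> * (s + r) / 2"
  have "\<kappa> * (s + r) / 2 < \<kappa> * sqrt 2 / 2" using lt \<kappa> by (simp add: s_def r_def)
  also have "\<kappa> * sqrt 2 / 2 = a * b" by (simp add: \<kappa>_def)
  finally have \<gamma>: "\<gamma> > 0" by (simp add: \<gamma>_def)
  \<comment> \<open>Half of the value at which the mean slope \<gamma> - \<delta>/\<kappa> vanishes.\<close>
  define \<delta> where "\<delta> = \<kappa> * \<gamma> / 2"
  have \<delta>: "\<delta> > 0" using \<kappa> \<gamma> by (simp add: \<delta>_def)
  have "ereal \<delta> \<le> (SUP q. ereal (H \<alpha> \<beta> q (grad f q)))" if f: "f \<in> C_infinity" for f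
  proof (rule ccontr)
    assume "\<not> ?thesis"
    then have "ereal (H \<alpha> \<beta> q (grad f q)) \<le> ereal \<delta>" for q
      by (meson SUP_upper UNIV_I dual_order.trans linorder_not_le order_less_imp_le)
    then have H: "H \<alpha> \<beta> q (grad f q) \<le> \<delta>" for q by simp
    have "C_k (Suc 0) f" using f by (simp add: C_infinity_def del: C_k.simps)
    then have "f differentiable at q" for q by (metis C_k.simps(2))
    then have diff: "(f has_derivative frechet_derivative f (at q)) (at q)" for q
      using frechet_derivative_works by blast
    define c where "c = (\<lambda>t. (a * cos t, b * sin t))"
    define g where "g = (\<lambda>t. f (c t))"
    define g' where "g' = (\<lambda>t. - fst (grad f (c t)) * (a * sin t) + snd (grad f (c t)) * (b * cos t))"
    have g: "(g has_real_derivative g' t) (at t)" for t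
    proof -
      let ?F = "frechet_derivative f (at (c t))"
      have lin: "linear ?F" using diff has_derivative_linear by blast
      have "(c has_derivative (\<lambda>h. (- (a * sin t * h), b * cos t * h))) (at t)"
        unfolding c_def by (auto intro!: derivative_eq_intros simp: fun_eq_iff)
      from has_derivative_compose[OF this diff]
      have "(g has_derivative (\<lambda>h. ?F (- (a * sin t * h), b * cos t * h))) (at t)"
        by (simp add: g_def)
      moreover have "?F (- (a * sin t * h), b * cos t * h) = g' t * h" for h
      proof -
        have "(- (a * sin t * h), b * cos t * h) =
            (- (a * sin t * h)) *\<^sub>R (1, 0) + (b * cos t * h) *\<^sub>R (0, 1)" by simp
        then have "?F (- (a * sin t * h), b * cos t * h) =
            - (a * sin t * h) * ?F (1, 0) + (b * cos t * h) * ?F (0, 1)"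
          using linear_add[OF lin] linear_scale[OF lin] by (metis real_scaleR_def)
        then show ?thesis by (simp add: g'_def grad_def algebra_simps)
      qed
      ultimately show ?thesis by (simp add: has_field_derivative_def)
    qed
    have lower: "a * b - \<delta> / \<kappa> - \<kappa> * (s * (cos t)\<^sup>2 + r * (sin t)\<^sup>2) \<le> g' t" for t
    proof -
      define C S where "C = cos t" and "S = sin t"
      have CS: "S\<^sup>2 + C\<^sup>2 = 1" by (simp add: C_def S_def)
      define w where "w = s * C\<^sup>2 + r * S\<^sup>2"
      define P1 P2 where "P1 = fst (grad f (c t)) + b * S" and "P2 = snd (grad f (c t)) - a * C"
      have "H \<alpha> \<beta> (c t) (grad f (c t)) = (P1\<^sup>2 + P2\<^sup>2) / 2 - \<alpha> * (a * C)\<^sup>2 - \<beta> * (b * S)\<^sup>2"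
        by (cases "grad f (c t)") (simp add: H_def c_def P1_def P2_def C_def S_def)
      also have "\<dots> = (P1\<^sup>2 + P2\<^sup>2) / 2 - s * r * w"
        unfolding w_def power_mult_distrib sq(3,4) sq(1,2)[symmetric] by (simp add: power2_eq_square algebra_simps)
      finally have "(P1\<^sup>2 + P2\<^sup>2) / 2 - s * r * w \<le> \<delta>" using H[of "c t"] by simp
      moreover have "\<kappa>\<^sup>2 * w = 2 * (s * r * w)" by (simp add: \<kappa>2)
      moreover have "m \<le> 2 * \<delta> + n" if "m / 2 - k \<le> \<delta>" "n = 2 * k" for m n k :: real
        using that by linarith
      ultimately have P: "P1\<^sup>2 + P2\<^sup>2 \<le> 2 * \<delta> + \<kappa>\<^sup>2 * w" by blast
      have "g' t = P2 * (b * C) - P1 * (a * S) + a * b * (S\<^sup>2 + C\<^sup>2)"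
        unfolding g'_def P1_def P2_def C_def[symmetric] S_def[symmetric]
        by (simp add: power2_eq_square algebra_simps)
      then have g': "g' t = P2 * (b * C) - P1 * (a * S) + a * b" by (simp add: CS)
      \<comment> \<open>The estimate of p(c') against |p|^2 and |c'|^2, as a square.\<close>
      have "0 \<le> (P1 - \<kappa> * (a * S))\<^sup>2 + (P2 + \<kappa> * (b * C))\<^sup>2" by simp
      also have "\<dots> = (P1\<^sup>2 + P2\<^sup>2) + \<kappa>\<^sup>2 * (b\<^sup>2 * C\<^sup>2 + a\<^sup>2 * S\<^sup>2) + 2 * \<kappa> * (g' t - a * b)"
        unfolding g' by (simp add: power2_eq_square algebra_simps)
      also have "\<dots> \<le> 2 * \<delta> + \<kappa>\<^sup>2 * w + \<kappa>\<^sup>2 * w + 2 * \<kappa> * (g' t - a * b)"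
        using P unfolding w_def sq by simp
      also have "\<dots> = 2 * \<kappa> * (\<delta> / \<kappa> + \<kappa> * w + g' t - a * b)"
        using \<kappa> by (simp add: field_simps power2_eq_square)
      finally have "0 \<le> \<delta> / \<kappa> + \<kappa> * w + g' t - a * b"
        using \<kappa> by (simp add: zero_le_mult_iff)
      then show ?thesis unfolding w_def C_def S_def by linarith
    qed
    \<comment> \<open>The derivative of h is the excess of that of g over its lower bound; the sine integrates the
      oscillating part of that bound.\<close>
    define h where "h = (\<lambda>t. g t - (\<gamma> - \<delta> / \<kappa>) * t + \<kappa> * (s - r) / 4 * sin (2 * t))"
    have "h 0 \<le> h (2 * pi)"
    proof (rule DERIV_nonneg_imp_nondecreasing[of 0 "2 * pi" h])
      show "0 \<le> 2 * pi" by simp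
      fix t :: real
      have "(h has_real_derivative g' t - (\<gamma> - \<delta> / \<kappa>) + \<kappa> * (s - r) / 2 * cos (2 * t)) (at t)"
        unfolding h_def by (auto intro!: derivative_eq_intros g)
      moreover have "(s + r) / 2 + (s - r) / 2 * cos (2 * t) = s * (cos t)\<^sup>2 + r * (sin t)\<^sup>2"
        unfolding cos_double sin_squared_eq by (simp add: field_simps)
      then have "\<kappa> * (s + r) / 2 + \<kappa> * (s - r) / 2 * cos (2 * t) = \<kappa> * (s * (cos t)\<^sup>2 + r * (sin t)\<^sup>2)"
        by (metis distrib_left mult.assoc times_divide_eq_right)
      then have "0 \<le> g' t - (\<gamma> - \<delta> / \<kappa>) + \<kappa> * (s - r) / 2 * cos (2 * t)"
        using lower[of t] unfolding \<gamma>_def by linarith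
      ultimately show "\<exists>y. (h has_real_derivative y) (at t) \<and> 0 \<le> y" by blast
    qed
    moreover have "sin (2 * (2 * pi)) = 0"
      using sin_npi[of 4] by (simp add: mult.commute mult.left_commute)
    moreover have "g (2 * pi) = g 0" by (simp add: g_def c_def)
    ultimately have "(\<gamma> - \<delta> / \<kappa>) * (2 * pi) \<le> 0" by (simp add: h_def)
    moreover have "\<gamma> - \<delta> / \<kappa> = \<gamma> / 2" using \<kappa> by (simp add: \<delta>_def)
    ultimately show False using \<gamma> pi_gt_zero by (simp add: mult_le_0_iff)
  qed
  then have "ereal \<delta> \<le> mane_critical_value (H \<alpha> \<beta>)"
    unfolding mane_critical_value_def by (rule INF_greatest)
  moreover have "0 < ereal \<delta>" using \<delta> by simp
  ultimately show ?thesis by (rule less_le_trans[rotated])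
qed

section \<open>Boundaries given by conics centred at the origin\<close>

text \<open>Scaling a point of the level set towards the origin lowers the value of the form, because
  c > 0; so each such point is a limit of points of the sublevel set.\<close>

lemma frontier_quadratic_sublevel:
  fixes a b c :: real
  assumes c: "c > 0"
  shows "frontier {(x, y). a * x\<^sup>2 + b * y\<^sup>2 < c} = {(x, y). a * x\<^sup>2 + b * y\<^sup>2 = c}"
proof -
  define Q where "Q = (\<lambda>q::real \<times> real. a * (fst q)\<^sup>2 + b * (snd q)\<^sup>2)"
  have cont: "continuous_on UNIV Q" unfolding Q_def by (intro continuous_intros)
  have open_lt: "open {q. Q q < c}" and closed_le: "closed {q. Q q \<le> c}"
    using cont by (auto intro!: open_Collect_less closed_Collect_le continuous_intros)
  have "frontier {q. Q q < c} = {q. Q q = c}"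
  proof (rule subset_antisym)
    have "closure {q. Q q < c} \<subseteq> {q. Q q \<le> c}"
      using closed_le by (intro closure_minimal) auto
    then show "frontier {q. Q q < c} \<subseteq> {q. Q q = c}"
      unfolding frontier_def interior_open[OF open_lt] by auto
    show "{q. Q q = c} \<subseteq> frontier {q. Q q < c}"
    proof
      fix q assume "q \<in> {q. Q q = c}"
      then have q: "Q q = c" by simp
      define u where "u = (\<lambda>n. 1 - inverse (real (Suc n)))"
      have "(\<lambda>n. u n *\<^sub>R q) \<longlonglongrightarrow> (1 - 0) *\<^sub>R q"
        unfolding u_def by (intro tendsto_intros LIMSEQ_inverse_real_of_nat)
      moreover have "Q (u n *\<^sub>R q) < c" for n
      proof -
        have "Q (u n *\<^sub>R q) = (u n)\<^sup>2 * Q q"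
          by (simp add: Q_def power_mult_distrib algebra_simps)
        moreover have "0 \<le> u n" "u n < 1" by (auto simp: u_def field_simps)
        then have "(u n)\<^sup>2 < 1" by (simp add: power_less_one_iff)
        ultimately show ?thesis using q c by simp
      qed
      ultimately have "q \<in> closure {q. Q q < c}"
        unfolding closure_sequential by (intro exI[of _ "\<lambda>n. u n *\<^sub>R q"]) auto
      then show "q \<in> frontier {q. Q q < c}"
        unfolding frontier_def interior_open[OF open_lt] using q by auto
    qed
  qed
  then show ?thesis by (simp add: Q_def case_prod_unfold)
qed

lemma is_hyperbola_indefinite_conic:
  fixes a b c :: real
  assumes "a * b < 0" "c > 0"
  shows "is_hyperbola {(x, y). a * x\<^sup>2 + b * y\<^sup>2 = c}"
proof -
  have main: "c * (x\<^sup>2 / (sqrt (c / a))\<^sup>2 - y\<^sup>2 / (sqrt (c / - b))\<^sup>2) = a * x\<^sup>2 + b * y\<^sup>2"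
    if "a > 0" "b < 0" for a b x y :: real
    using that assms(2) by (simp add: field_simps)
  have iff: "(a * x\<^sup>2 + b * y\<^sup>2 = c) \<longleftrightarrow> x\<^sup>2 / (sqrt (c / a))\<^sup>2 - y\<^sup>2 / (sqrt (c / - b))\<^sup>2 = 1"
    if "a > 0" "b < 0" for a b x y :: real
    using main[OF that, of x y] assms(2) by (metis mult.right_neutral mult_left_cancel less_irrefl)
  show ?thesis
  proof (cases "a > 0")
    case True
    with assms have b: "b < 0" by (simp add: mult_less_0_iff)
    have "{(x, y). a * x\<^sup>2 + b * y\<^sup>2 = c} =
        {q. (inner (q - 0) (1, 0))\<^sup>2 / (sqrt (c / a))\<^sup>2 - (inner (q - 0) (0, 1))\<^sup>2 / (sqrt (c / - b))\<^sup>2 = 1}"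
      unfolding set_eq_iff by (auto simp del: real_sqrt_pow2_iff simp: iff[OF True b] inner_prod_def)
    then show ?thesis
      unfolding is_hyperbola_def using True b assms(2)
      by (intro exI[of _ 0] exI[of _ "(1, 0)"] exI[of _ "(0, 1)"] exI[of _ "sqrt (c / a)"]
          exI[of _ "sqrt (c / - b)"]) (simp add: norm_Pair divide_neg_neg divide_pos_neg)
  next
    case False
    with assms have ab: "b > 0" "a < 0" by (auto simp: mult_less_0_iff)
    have "(a * x\<^sup>2 + b * y\<^sup>2 = c) \<longleftrightarrow> y\<^sup>2 / (sqrt (c / b))\<^sup>2 - x\<^sup>2 / (sqrt (c / - a))\<^sup>2 = 1" for x y
      using iff[OF ab, of y x] by (simp only: add.commute)
    then have "{(x, y). a * x\<^sup>2 + b * y\<^sup>2 = c} =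
        {q. (inner (q - 0) (0, 1))\<^sup>2 / (sqrt (c / b))\<^sup>2 - (inner (q - 0) (1, 0))\<^sup>2 / (sqrt (c / - a))\<^sup>2 = 1}"
      unfolding set_eq_iff by (auto simp del: real_sqrt_pow2_iff simp: inner_prod_def)
    then show ?thesis
      unfolding is_hyperbola_def using ab assms(2)
      by (intro exI[of _ 0] exI[of _ "(0, 1)"] exI[of _ "(1, 0)"] exI[of _ "sqrt (c / b)"]
          exI[of _ "sqrt (c / - a)"]) (simp add: norm_Pair divide_neg_neg divide_pos_neg)
  qed
qed

text \<open>Reflecting a hyperbola in either of its axes moves its points arbitrarily far in the direction
  of the other axis, whereas the parallelogram law bounds a nonnegative form Q on differences of
  points with Q = c. So Q vanishes on both axes; these span the plane, and Q = 0.\<close>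

lemma not_is_hyperbola_semidefinite_conic:
  fixes a b c :: real
  assumes ab: "a \<ge> 0" "b \<ge> 0" "a \<noteq> 0 \<or> b \<noteq> 0"
  shows "\<not> is_hyperbola {(x, y). a * x\<^sup>2 + b * y\<^sup>2 = c}"
proof
  define Q where "Q = (\<lambda>q::real \<times> real. a * (fst q)\<^sup>2 + b * (snd q)\<^sup>2)"
  have Q_nonneg: "Q q \<ge> 0" for q using ab by (simp add: Q_def)
  have Q_scale: "Q (m *\<^sub>R q) = m\<^sup>2 * Q q" for m q
    by (simp add: Q_def power_mult_distrib algebra_simps)
  have Q_diff: "Q (p - q) \<le> 2 * Q p + 2 * Q q" for p q
  proof -
    have "2 * Q p + 2 * Q q - Q (p - q) = Q (p + q)"
      by (simp add: Q_def power2_eq_square algebra_simps)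
    then show ?thesis using Q_nonneg[of "p + q"] by linarith
  qed
  have vanish: "z = 0" if "z \<ge> 0" "\<And>n::nat. (real n)\<^sup>2 * z \<le> d" for z d :: real
  proof (rule ccontr)
    assume "z \<noteq> 0"
    then have "z > 0" using that by simp
    obtain n :: nat where n: "d / z < real n" using reals_Archimedean2 by blast
    have "n \<le> n\<^sup>2" by (cases n) (auto simp: power2_eq_square)
    then have "real n \<le> (real n)\<^sup>2" by (simp flip: of_nat_power)
    then have "d / z < (real n)\<^sup>2" using n by linarith
    then have "d < (real n)\<^sup>2 * z" using \<open>z > 0\<close> by (simp add: field_simps)
    then show False using that(2)[of n] by linarith
  qed
  assume "is_hyperbola {(x, y). a * x\<^sup>2 + b * y\<^sup>2 = c}"
  then obtain o' u w A B where uw: "norm u = 1" "norm w = 1" "inner u w = 0" "A > 0" "B > 0"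
    and S: "{(x, y). a * x\<^sup>2 + b * y\<^sup>2 = c} =
      {q. (inner (q - o') u)\<^sup>2 / A\<^sup>2 - (inner (q - o') w)\<^sup>2 / B\<^sup>2 = 1}"
    unfolding is_hyperbola_def by (elim exE conjE) blast
  have uu: "inner u u = 1" "inner w w = 1" "inner w u = 0"
    using uw by (simp_all add: dot_square_norm inner_commute)
  have on: "Q (o' + (A * X) *\<^sub>R u + (B * Y) *\<^sub>R w) = c" if "X\<^sup>2 - Y\<^sup>2 = 1" for X Y
  proof -
    let ?q = "o' + (A * X) *\<^sub>R u + (B * Y) *\<^sub>R w"
    have "inner (?q - o') u = A * X" "inner (?q - o') w = B * Y"
      by (simp_all add: inner_add_left uu uw(3))
    then have "(inner (?q - o') u)\<^sup>2 / A\<^sup>2 - (inner (?q - o') w)\<^sup>2 / B\<^sup>2 = 1"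
      using that uw by (simp add: power_mult_distrib)
    then have "?q \<in> {(x, y). a * x\<^sup>2 + b * y\<^sup>2 = c}" unfolding S by simp
    then show ?thesis by (simp add: Q_def case_prod_unfold)
  qed
  have bounds: "(real n)\<^sup>2 * (4 * A\<^sup>2 * Q u) \<le> 4 * c" "(real n)\<^sup>2 * (4 * B\<^sup>2 * Q w) \<le> 4 * c" for n
  proof -
    define X Y where "X = sqrt (1 + (real n)\<^sup>2)" and "Y = real n"
    have XY: "X\<^sup>2 = 1 + Y\<^sup>2" by (simp add: X_def Y_def)
    have pts: "Q (o' + (A * X) *\<^sub>R u + (B * Y) *\<^sub>R w) = c"
      "Q (o' + (A * (- X)) *\<^sub>R u + (B * Y) *\<^sub>R w) = c"
      "Q (o' + (A * X) *\<^sub>R u + (B * (- Y)) *\<^sub>R w) = c"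
      using XY on[of X Y] on[of "- X" Y] on[of X "- Y"] by simp_all
    have "Q ((2 * A * X) *\<^sub>R u) \<le> 4 * c"
      using Q_diff[of "o' + (A * X) *\<^sub>R u + (B * Y) *\<^sub>R w" "o' + (A * (- X)) *\<^sub>R u + (B * Y) *\<^sub>R w"]
      unfolding pts by (simp add: scaleR_2[symmetric] mult.assoc flip: scaleR_scaleR)
    then have 1: "4 * A\<^sup>2 * (1 + Y\<^sup>2) * Q u \<le> 4 * c"
      unfolding Q_scale power_mult_distrib XY by simp
    have "0 \<le> 4 * A\<^sup>2 * Q u" using Q_nonneg by simp
    with 1 have "Y\<^sup>2 * (4 * A\<^sup>2 * Q u) \<le> 4 * c" by (simp add: algebra_simps)
    then show "(real n)\<^sup>2 * (4 * A\<^sup>2 * Q u) \<le> 4 * c" unfolding Y_def .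
    have "Q ((2 * B * Y) *\<^sub>R w) \<le> 4 * c"
      using Q_diff[of "o' + (A * X) *\<^sub>R u + (B * Y) *\<^sub>R w" "o' + (A * X) *\<^sub>R u + (B * (- Y)) *\<^sub>R w"]
      unfolding pts by (simp add: scaleR_2[symmetric] mult.assoc flip: scaleR_scaleR)
    then show "(real n)\<^sup>2 * (4 * B\<^sup>2 * Q w) \<le> 4 * c"
      unfolding Q_scale power_mult_distrib Y_def by (simp add: algebra_simps)
  qed
  have "4 * A\<^sup>2 * Q u = 0" "4 * B\<^sup>2 * Q w = 0"
    by (rule vanish[OF _ bounds(1)], simp add: Q_nonneg)
      (rule vanish[OF _ bounds(2)], simp add: Q_nonneg)
  then have Q0: "Q u = 0" "Q w = 0" using uw by auto
  define u1 u2 w1 w2 where "u1 = fst u" and "u2 = snd u" and "w1 = fst w" and "w2 = snd w"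
  have orth: "u1\<^sup>2 + u2\<^sup>2 = 1" "w1\<^sup>2 + w2\<^sup>2 = 1" "u1 * w1 + u2 * w2 = 0"
    using uu uw(3) by (auto simp: inner_prod_def power2_eq_square u1_def u2_def w1_def w2_def)
  have zero: "a * u1\<^sup>2 = 0" "b * u2\<^sup>2 = 0" "a * w1\<^sup>2 = 0" "b * w2\<^sup>2 = 0"
    using Q0 ab unfolding Q_def u1_def u2_def w1_def w2_def
    by (auto simp: add_nonneg_eq_0_iff)
  have "a = 0 \<and> b = 0"
  proof (rule ccontr)
    assume "\<not> ?thesis"
    then have "u1 = 0 \<and> w1 = 0 \<or> u2 = 0 \<and> w2 = 0" using zero by auto
    then show False using orth by (auto simp: power2_eq_1_iff)
  qed
  with ab show False by simp
qed

section \<open>The set of positive curvature\<close>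

text \<open>The quotient |grad V| / |v| on the energy level e; up to the factor b = 2 it compares the
  electric with the magnetic force.\<close>

definition force_ratio :: "real \<Rightarrow> real \<Rightarrow> real \<Rightarrow> real \<times> real \<Rightarrow> real" where
  "force_ratio \<alpha> \<beta> e = (\<lambda>(x, y).
     sqrt (2 * (\<alpha>\<^sup>2 * x\<^sup>2 + \<beta>\<^sup>2 * y\<^sup>2) / (e + \<alpha> * x\<^sup>2 + \<beta> * y\<^sup>2)))"

lemma em_curvature_common_denominator:
  assumes v: "((x, y), r *\<^sub>R (cos \<phi>, sin \<phi>)) \<in> energy_level (V \<alpha> \<beta>) e" and "r > 0"
  defines "W \<equiv> e + \<alpha> * x\<^sup>2 + \<beta> * y\<^sup>2"
  shows "em_curvature (V \<alpha> \<beta>) \<theta> e (x, y) (r *\<^sub>R (cos \<phi>, sin \<phi>)) =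
    ((2 - \<alpha> - \<beta>) * W + 2 * (\<alpha>\<^sup>2 * x\<^sup>2 + \<beta>\<^sup>2 * y\<^sup>2)
      - 2 * sqrt 2 * (\<alpha> * x * sin \<phi> - \<beta> * y * cos \<phi>) * sqrt W) / (2 * W ^ 3)"
proof -
  have "(norm (r *\<^sub>R (cos \<phi>, sin \<phi>)))\<^sup>2 = r\<^sup>2"
    unfolding norm_scaleR norm_Pair by simp
  then have "r\<^sup>2 / 2 = W"
    using v unfolding energy_level_def W_def by (simp add: V_def)
  then have "W > 0" using \<open>r > 0\<close> by (metis half_gt_zero zero_less_power)
  define S where "S = sqrt W"
  have S: "S > 0" "W = S\<^sup>2" using \<open>W > 0\<close> by (auto simp: S_def)
  have "W = S powr 2" using S by simp
  then have "W powr (5 / 2) = S powr 5" by (simp only: powr_powr) simp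
  then have p: "W powr (5 / 2) = S ^ 5" using S(1) by simp
  have calc: "m / (2 * (S\<^sup>2)\<^sup>2) + n / (S\<^sup>2) ^ 3 - k * d / S ^ 5
      = (m * S\<^sup>2 + 2 * n - 2 * k * d * S) / (2 * (S\<^sup>2) ^ 3)" for m n k d
    using S(1) by (simp add: divide_simps eval_nat_numeral)
  show ?thesis
    unfolding em_curvature_eq[OF v \<open>r > 0\<close>, folded W_def] p
    unfolding S_def[symmetric] unfolding S(2) by (rule calc)
qed

text \<open>The direction enters the curvature through \<alpha>x sin \<phi> - \<beta>y cos \<phi>, whose maximum over \<phi> is
  N = |grad V| / 2. With this value the numerator of the curvature is a quadratic polynomial in the
  force ratio t, equal to W((t - 1)^2 - (\<alpha> + \<beta> - 1)).\<close>

lemma mem_positive_curvature_set_iff: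
  assumes p: "\<alpha> > 0" "\<beta> > 0" and e: "e > 0"
  shows "q \<in> positive_curvature_set (V \<alpha> \<beta>) \<theta> e \<longleftrightarrow> (force_ratio \<alpha> \<beta> e q - 1)\<^sup>2 > \<alpha> + \<beta> - 1"
proof -
  obtain x y where q: "q = (x, y)" by (cases q)
  define W where "W = e + \<alpha> * x\<^sup>2 + \<beta> * y\<^sup>2"
  have W: "W > 0" using p e by (simp add: W_def add_pos_nonneg)
  define N where "N = sqrt (\<alpha>\<^sup>2 * x\<^sup>2 + \<beta>\<^sup>2 * y\<^sup>2)"
  have N: "N \<ge> 0" "N\<^sup>2 = \<alpha>\<^sup>2 * x\<^sup>2 + \<beta>\<^sup>2 * y\<^sup>2" by (auto simp: N_def)
  define F where "F = (\<lambda>d. (2 - \<alpha> - \<beta>) * W + 2 * N\<^sup>2 - 2 * sqrt 2 * d * sqrt W)"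
  have F_mono: "F d' \<le> F d" if "d \<le> d'" for d d'
    using that W by (simp add: F_def mult_right_mono)
  have K: "em_curvature (V \<alpha> \<beta>) \<theta> e q (r *\<^sub>R (cos \<phi>, sin \<phi>)) > 0 \<longleftrightarrow>
      F (\<alpha> * x * sin \<phi> - \<beta> * y * cos \<phi>) > 0"
    if "(q, r *\<^sub>R (cos \<phi>, sin \<phi>)) \<in> energy_level (V \<alpha> \<beta>) e" "r > 0" for r \<phi>
    unfolding q em_curvature_common_denominator[OF that[unfolded q], folded W_def N(2)] F_def
    using W by (simp add: zero_less_divide_iff)
  have "q \<in> positive_curvature_set (V \<alpha> \<beta>) \<theta> e \<longleftrightarrow> F N > 0"
  proof
    assume P: "q \<in> positive_curvature_set (V \<alpha> \<beta>) \<theta> e"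
    obtain \<phi> where \<phi>: "\<alpha> * x * sin \<phi> - \<beta> * y * cos \<phi> = N"
    proof (cases "N = 0")
      case True
      then have "\<alpha> * x = 0" "\<beta> * y = 0"
        using N(2) by (auto simp: add_nonneg_eq_0_iff)
      then have "\<alpha> * x * sin 0 - \<beta> * y * cos 0 = N" using True by simp
      then show ?thesis by (rule that)
    next
      case False
      have "(- \<beta> * y / N)\<^sup>2 + (\<alpha> * x / N)\<^sup>2 = N\<^sup>2 / N\<^sup>2"
        unfolding N(2) by (simp add: power_divide power_mult_distrib add.commute flip: add_divide_distrib N(2))
      also have "\<dots> = 1" using False by simp
      finally obtain \<phi> where "- \<beta> * y / N = cos \<phi>" "\<alpha> * x / N = sin \<phi>"
        using sincos_total_2pi by metis
      then have xy: "\<alpha> * x = N * sin \<phi>" "\<beta> * y = - N * cos \<phi>"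
        using False by (auto simp: field_simps)
      have "N * s * s - - N * c * c = N * (s\<^sup>2 + c\<^sup>2)" for s c
        by (simp add: power2_eq_square algebra_simps)
      then have "\<alpha> * x * sin \<phi> - \<beta> * y * cos \<phi> = N * ((sin \<phi>)\<^sup>2 + (cos \<phi>)\<^sup>2)"
        unfolding xy .
      then show ?thesis using that by simp
    qed
    have nrm: "(norm (sqrt (2 * W) *\<^sub>R (cos \<phi>, sin \<phi>)))\<^sup>2 = 2 * W"
      unfolding norm_scaleR norm_Pair using W by simp
    have "(norm (sqrt (2 * W) *\<^sub>R (cos \<phi>, sin \<phi>)))\<^sup>2 / 2 + V \<alpha> \<beta> q = e"
      unfolding nrm by (simp add: q V_def W_def field_simps)
    then have lev: "(q, sqrt (2 * W) *\<^sub>R (cos \<phi>, sin \<phi>)) \<in> energy_level (V \<alpha> \<beta>) e"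
      by (simp only: energy_level_def mem_Collect_eq case_prod_conv)
    show "F N > 0"
      using P lev K[OF lev] W unfolding positive_curvature_set_def \<phi> by auto
  next
    assume F: "F N > 0"
    show "q \<in> positive_curvature_set (V \<alpha> \<beta>) \<theta> e"
      unfolding positive_curvature_set_def
    proof (intro CollectI allI impI)
      fix v assume v: "(q, v) \<in> energy_level (V \<alpha> \<beta>) e"
      have "(norm v)\<^sup>2 / 2 = W"
        using v by (simp add: energy_level_def V_def W_def q algebra_simps)
      then have nv: "norm v > 0" using W by auto
      have "(fst v / norm v)\<^sup>2 + (snd v / norm v)\<^sup>2 = (norm v)\<^sup>2 / (norm v)\<^sup>2"
        by (cases v) (simp add: norm_Pair power_divide flip: add_divide_distrib)
      then have "(fst v / norm v)\<^sup>2 + (snd v / norm v)\<^sup>2 = 1" using nv by simp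
      then obtain \<phi> where \<phi>: "fst v / norm v = cos \<phi>" "snd v / norm v = sin \<phi>"
        using sincos_total_2pi by metis
      have v_eq: "v = norm v *\<^sub>R (cos \<phi>, sin \<phi>)"
        using nv unfolding \<phi>[symmetric] by (simp add: prod_eq_iff)
      define D where "D = \<alpha> * x * sin \<phi> - \<beta> * y * cos \<phi>"
      have "(\<alpha> * x * s - \<beta> * y * c)\<^sup>2 + (\<alpha> * x * c + \<beta> * y * s)\<^sup>2 = N\<^sup>2 * (s\<^sup>2 + c\<^sup>2)" for s c
        unfolding N(2) by (simp add: power2_eq_square algebra_simps)
      then have "D\<^sup>2 + (\<alpha> * x * cos \<phi> + \<beta> * y * sin \<phi>)\<^sup>2 = N\<^sup>2 * ((sin \<phi>)\<^sup>2 + (cos \<phi>)\<^sup>2)"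
        unfolding D_def .
      then have "D\<^sup>2 \<le> N\<^sup>2"
        by (metis le_add_same_cancel1 mult.right_neutral sin_cos_squared_add zero_le_power2)
      then have "D \<le> N" using N(1) by (rule power2_le_imp_le)
      then have "F D > 0" using F F_mono[of D N] by linarith
      then show "em_curvature (V \<alpha> \<beta>) \<theta> e q v > 0"
        using K[of "norm v" \<phi>] v nv unfolding D_def v_eq[symmetric] by blast
    qed
  qed
  also have "\<dots> \<longleftrightarrow> (force_ratio \<alpha> \<beta> e q - 1)\<^sup>2 > \<alpha> + \<beta> - 1"
  proof -
    define t where "t = force_ratio \<alpha> \<beta> e q"
    have "sqrt (2 * n / W) = sqrt 2 * sqrt n / sqrt W" for n
      by (simp add: real_sqrt_mult real_sqrt_divide)
    then have t: "t = sqrt 2 * N / sqrt W"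
      unfolding t_def force_ratio_def q N_def W_def case_prod_conv .
    then have "sqrt 2 * N = t * sqrt W" using W by simp
    moreover have "2 * N\<^sup>2 = (sqrt 2 * N)\<^sup>2" by (simp add: power_mult_distrib)
    moreover have "F N = (2 - \<alpha> - \<beta>) * W + 2 * N\<^sup>2 - 2 * (sqrt 2 * N) * sqrt W"
      by (simp add: F_def)
    ultimately have "F N = (2 - \<alpha> - \<beta>) * W + (t * sqrt W)\<^sup>2 - 2 * (t * sqrt W) * sqrt W"
      by simp
    also have "\<dots> = (2 - \<alpha> - \<beta>) * (sqrt W)\<^sup>2 + (t * sqrt W)\<^sup>2 - 2 * (t * sqrt W) * sqrt W"
      using W by simp
    also have "\<dots> = (sqrt W)\<^sup>2 * ((t - 1)\<^sup>2 - (\<alpha> + \<beta> - 1))"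
      by (simp add: power2_eq_square algebra_simps del: real_sqrt_mult_self)
    finally have "F N = W * ((t - 1)\<^sup>2 - (\<alpha> + \<beta> - 1))" using W by simp
    then show ?thesis using W by (simp add: zero_less_mult_iff t_def)
  qed
  finally show ?thesis .
qed

lemma force_ratio_origin: "force_ratio \<alpha> \<beta> e (0, 0) = 0"
  by (simp add: force_ratio_def)

lemma continuous_on_force_ratio:
  assumes "\<alpha> > 0" "\<beta> > 0" "e > 0"
  shows "continuous_on UNIV (force_ratio \<alpha> \<beta> e)"
proof -
  have "e + \<alpha> * x\<^sup>2 + \<beta> * y\<^sup>2 \<noteq> 0" for x y
    using assms by (smt (verit) mult_nonneg_nonneg zero_le_power2)
  then show ?thesis
    unfolding force_ratio_def case_prod_beta by (auto intro!: continuous_intros)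
qed

text \<open>The positive set is the union of the disjoint open sets where the force ratio is less than
  1 - \<rho> or greater than 1 + \<rho>, with \<rho> = sqrt (\<alpha> + \<beta> - 1). The first contains the origin and is
  a sublevel set of a quadratic form, hence starlike.\<close>

lemma component_of_positive_curvature:
  assumes p: "\<alpha> > 0" "\<beta> > 0" and e: "e > 0" and s: "1 \<le> \<alpha> + \<beta>" "\<alpha> + \<beta> < 2"
  defines "k \<equiv> (1 - sqrt (\<alpha> + \<beta> - 1))\<^sup>2 / 2"
  shows "connected_component_set (positive_curvature_set (V \<alpha> \<beta>) \<theta> e) (0, 0) =
    {(x, y). \<alpha> * (\<alpha> - k) * x\<^sup>2 + \<beta> * (\<beta> - k) * y\<^sup>2 < k * e}"
    (is "connected_component_set ?P _ = ?C")
proof -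
  define \<rho> where "\<rho> = sqrt (\<alpha> + \<beta> - 1)"
  have \<rho>: "0 \<le> \<rho>" "\<rho> < 1" "\<rho>\<^sup>2 = \<alpha> + \<beta> - 1"
    using s by (auto simp: \<rho>_def real_sqrt_lt_1_iff)
  have k: "2 * k = (1 - \<rho>)\<^sup>2" "k > 0" using \<rho> by (auto simp: k_def \<rho>_def[symmetric])
  define U U' where "U = {q. force_ratio \<alpha> \<beta> e q < 1 - \<rho>}" and "U' = {q. force_ratio \<alpha> \<beta> e q > 1 + \<rho>}"
  have opens: "open U" "open U'"
    unfolding U_def U'_def using continuous_on_force_ratio[OF p e]
    by (auto intro!: open_Collect_less continuous_intros)
  have disj: "U \<inter> U' = {}" using \<rho> by (auto simp: U_def U'_def)
  have P_eq: "?P = U \<union> U'"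
  proof -
    have "(t - 1)\<^sup>2 > \<alpha> + \<beta> - 1 \<longleftrightarrow> t < 1 - \<rho> \<or> t > 1 + \<rho>" for t
    proof -
      have "(t - 1)\<^sup>2 > \<alpha> + \<beta> - 1 \<longleftrightarrow> \<not> \<bar>t - 1\<bar> \<le> \<rho>"
        unfolding \<rho>(3)[symmetric] not_le[symmetric] power2_le_iff_abs_le[OF \<rho>(1)] ..
      then show ?thesis by (simp add: abs_le_iff) linarith
    qed
    then show ?thesis
      using mem_positive_curvature_set_iff[OF p e] by (auto simp: U_def U'_def)
  qed
  have U_eq: "U = ?C"
  proof -
    have "force_ratio \<alpha> \<beta> e (x, y) < 1 - \<rho> \<longleftrightarrow> \<alpha> * (\<alpha> - k) * x\<^sup>2 + \<beta> * (\<beta> - k) * y\<^sup>2 < k * e" for x y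
    proof -
      define W where "W = e + \<alpha> * x\<^sup>2 + \<beta> * y\<^sup>2"
      have W: "W > 0" using p e by (simp add: W_def add_pos_nonneg)
      define n where "n = \<alpha>\<^sup>2 * x\<^sup>2 + \<beta>\<^sup>2 * y\<^sup>2"
      have "n \<ge> 0" by (simp add: n_def)
      have "force_ratio \<alpha> \<beta> e (x, y) < 1 - \<rho> \<longleftrightarrow> sqrt (2 * n / W) < sqrt ((1 - \<rho>)\<^sup>2)"
        unfolding force_ratio_def n_def W_def using \<rho> by simp
      also have "\<dots> \<longleftrightarrow> 2 * n / W < 2 * k" unfolding real_sqrt_less_iff k(1) ..
      also have "\<dots> \<longleftrightarrow> n < k * W" using W by (simp add: field_simps)
      also have "\<dots> \<longleftrightarrow> \<alpha> * (\<alpha> - k) * x\<^sup>2 + \<beta> * (\<beta> - k) * y\<^sup>2 < k * e"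
        unfolding n_def W_def by (simp add: power2_eq_square algebra_simps)
      finally show ?thesis .
    qed
    then show ?thesis by (auto simp: U_def)
  qed
  have zero_U: "(0, 0) \<in> U" using \<rho> by (simp add: U_def force_ratio_origin)
  have "starlike ?C"
    unfolding starlike_def
  proof (intro bexI ballI subsetI)
    show "(0, 0) \<in> ?C" using k e by simp
    fix q z assume q: "q \<in> ?C" and z: "z \<in> closed_segment (0, 0) q"
    obtain u where u: "0 \<le> u" "u \<le> 1" "z = u *\<^sub>R q"
      using z by (auto simp: closed_segment_def zero_prod_def[symmetric])
    obtain x y where xy: "q = (x, y)" by (cases q)
    define m where "m = \<alpha> * (\<alpha> - k) * x\<^sup>2 + \<beta> * (\<beta> - k) * y\<^sup>2"
    have m: "m < k * e" using q by (simp add: xy m_def)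
    have "u\<^sup>2 * m < k * e"
    proof (cases "m \<le> 0")
      case True
      then have "u\<^sup>2 * m \<le> 0" by (simp add: mult_nonneg_nonpos)
      moreover have "0 < k * e" using k e by simp
      ultimately show ?thesis by linarith
    next
      case False
      then have "u\<^sup>2 * m \<le> 1 * m" using u by (intro mult_right_mono) (auto simp: power_le_one)
      then show ?thesis using m by simp
    qed
    moreover have "u\<^sup>2 * m = \<alpha> * (\<alpha> - k) * (u * x)\<^sup>2 + \<beta> * (\<beta> - k) * (u * y)\<^sup>2"
      unfolding m_def by (simp add: power_mult_distrib algebra_simps)
    ultimately show "z \<in> ?C" by (simp add: u xy)
  qed
  then have conn: "connected U" unfolding U_eq by (rule starlike_imp_connected)
  have "connected_component_set ?P (0, 0) = U"
  proof (rule subset_antisym)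
    show "U \<subseteq> connected_component_set ?P (0, 0)"
      using zero_U conn P_eq by (intro connected_component_maximal) auto
    have in_comp: "(0, 0) \<in> connected_component_set ?P (0, 0)"
      using zero_U P_eq by simp
    have "connected_component_set ?P (0, 0) \<subseteq> U \<union> U'"
      using connected_component_subset P_eq by metis
    moreover from this have "U' \<inter> connected_component_set ?P (0, 0) = {}"
      using connectedD[OF connected_connected_component opens, of ?P "(0, 0)"] disj zero_U in_comp by blast
    ultimately show "connected_component_set ?P (0, 0) \<subseteq> U" by blast
  qed
  then show ?thesis unfolding U_eq .
qed

text \<open>The link between the sign pattern of the boundary conic and the stability threshold.\<close>

lemma curvature_threshold_identity:
  fixes \<alpha> \<beta> :: real
  assumes "1 \<le> \<alpha> + \<beta>"
  defines "k \<equiv> (1 - sqrt (\<alpha> + \<beta> - 1))\<^sup>2 / 2"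
  shows "4 * ((\<alpha> - k) * (\<beta> - k)) = 4 * (\<alpha> * \<beta>) - (2 - \<alpha> - \<beta>)\<^sup>2"
    and "2 * k = \<alpha> + \<beta> - 2 * sqrt (\<alpha> + \<beta> - 1)"
proof -
  define \<rho> where "\<rho> = sqrt (\<alpha> + \<beta> - 1)"
  have \<rho>: "\<rho>\<^sup>2 = \<alpha> + \<beta> - 1" using assms by (simp add: \<rho>_def)
  have k: "2 * k = \<alpha> + \<beta> - 2 * \<rho>"
    unfolding k_def \<rho>_def[symmetric] power2_diff \<rho> by simp
  then show "2 * k = \<alpha> + \<beta> - 2 * sqrt (\<alpha> + \<beta> - 1)" by (simp add: \<rho>_def)
  show "4 * ((\<alpha> - k) * (\<beta> - k)) = 4 * (\<alpha> * \<beta>) - (2 - \<alpha> - \<beta>)\<^sup>2"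
    using k \<rho> by Groebner_Basis.algebra
qed

lemma positive_curvature_set_UNIV:
  assumes "\<alpha> > 0" "\<beta> > 0" "e > 0" "\<alpha> + \<beta> < 1"
  shows "positive_curvature_set (V \<alpha> \<beta>) \<theta> e = UNIV"
proof -
  have "\<alpha> + \<beta> - 1 < (t - 1)\<^sup>2" for t :: real
    using assms(4) zero_le_power2[of "t - 1"] by linarith
  then show ?thesis using mem_positive_curvature_set_iff[OF assms(1-3)] by auto
qed

lemma curvature_condition_if_stable:
  assumes p: "\<alpha> > 0" "\<beta> > 0" and lt: "sqrt \<alpha> + sqrt \<beta> < sqrt 2"
  shows "curvature_condition \<alpha> \<beta>"
  unfolding curvature_condition_def Let_def
proof (intro allI impI conjI)
  fix e :: real assume e: "e > 0"
  let ?P = "positive_curvature_set (V \<alpha> \<beta>) \<theta> e"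
  have s: "\<alpha> + \<beta> < 2" "4 * (\<alpha> * \<beta>) < (2 - \<alpha> - \<beta>)\<^sup>2"
    using lt unfolding sqrt_sum_less_sqrt2_iff[OF p] by auto
  show "(0, 0) \<in> ?P"
    unfolding mem_positive_curvature_set_iff[OF p e] force_ratio_origin using s by simp
  show "frontier (connected_component_set ?P (0, 0)) = {}
    \<or> is_hyperbola (frontier (connected_component_set ?P (0, 0)))"
  proof (cases "\<alpha> + \<beta> < 1")
    case True
    then show ?thesis
      using positive_curvature_set_UNIV[OF p e] by (simp add: connected_component_UNIV)
  next
    case False
    define k where "k = (1 - sqrt (\<alpha> + \<beta> - 1))\<^sup>2 / 2"
    have s1: "1 \<le> \<alpha> + \<beta>" using False by simp
    have "sqrt (\<alpha> + \<beta> - 1) < 1" using s by (simp add: real_sqrt_lt_1_iff)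
    then have k: "k > 0" by (simp add: k_def)
    have "(\<alpha> - k) * (\<beta> - k) < 0"
      using curvature_threshold_identity(1)[OF s1, folded k_def] s by linarith
    then have "(\<alpha> * \<beta>) * ((\<alpha> - k) * (\<beta> - k)) < 0" using p by (simp add: mult_pos_neg)
    then have "(\<alpha> * (\<alpha> - k)) * (\<beta> * (\<beta> - k)) < 0" by (simp add: mult_ac)
    then show ?thesis
      unfolding component_of_positive_curvature[OF p e s1 s(1), folded k_def]
      using k e by (simp add: frontier_quadratic_sublevel is_hyperbola_indefinite_conic)
  qed
qed

text \<open>One energy decides. If \<alpha> - k and \<beta> - k do not have opposite signs, they cannot both be
  nonpositive: 2k \<le> \<alpha> + \<beta>, with equality only for \<alpha> + \<beta> = 1, which would give
  \<alpha> = \<beta> = k = 1/2. Hence both are nonnegative and the boundary conic is semidefinite; it meets a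
  coordinate axis, so it is neither empty nor a hyperbola.\<close>

lemma stable_if_curvature_condition:
  assumes p: "\<alpha> > 0" "\<beta> > 0" and cc: "curvature_condition \<alpha> \<beta>" and ne: "(\<alpha>, \<beta>) \<noteq> (1/2, 1/2)"
  shows "sqrt \<alpha> + sqrt \<beta> < sqrt 2"
proof -
  have one_pos: "(1::real) > 0" by simp
  define C where "C = connected_component_set (positive_curvature_set (V \<alpha> \<beta>) \<theta> 1) (0, 0)"
  have P: "(0, 0) \<in> positive_curvature_set (V \<alpha> \<beta>) \<theta> 1" and F: "frontier C = {} \<or> is_hyperbola (frontier C)"
    using cc unfolding curvature_condition_def Let_def C_def by auto
  have s2: "\<alpha> + \<beta> < 2"
    using P unfolding mem_positive_curvature_set_iff[OF p one_pos] force_ratio_origin by simp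
  show ?thesis
  proof (cases "\<alpha> + \<beta> < 1")
    case True
    have "0 \<le> (\<alpha> - \<beta>)\<^sup>2" by simp
    also have "\<dots> = (\<alpha> + \<beta>)\<^sup>2 - 4 * (\<alpha> * \<beta>)" by (simp add: power2_eq_square algebra_simps)
    finally have "4 * (\<alpha> * \<beta>) \<le> (\<alpha> + \<beta>)\<^sup>2" by simp
    also have "\<dots> < (2 - \<alpha> - \<beta>)\<^sup>2" using True p by (intro power_strict_mono) auto
    finally show ?thesis unfolding sqrt_sum_less_sqrt2_iff[OF p] using s2 by simp
  next
    case False
    then have s1: "1 \<le> \<alpha> + \<beta>" by simp
    define k where "k = (1 - sqrt (\<alpha> + \<beta> - 1))\<^sup>2 / 2"
    have "sqrt (\<alpha> + \<beta> - 1) < 1" using s2 by (simp add: real_sqrt_lt_1_iff)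
    then have k: "k > 0" by (simp add: k_def)
    define a b where "a = \<alpha> * (\<alpha> - k)" and "b = \<beta> * (\<beta> - k)"
    have fr: "frontier C = {(x, y). a * x\<^sup>2 + b * y\<^sup>2 = k}"
      unfolding C_def component_of_positive_curvature[OF p one_pos s1 s2, folded k_def] a_def b_def
      using k by (simp add: frontier_quadratic_sublevel)
    have "(\<alpha> - k) * (\<beta> - k) < 0"
    proof (rule ccontr)
      assume neg: "\<not> ?thesis"
      have "\<alpha> - k \<ge> 0 \<and> \<beta> - k \<ge> 0 \<and> (\<alpha> \<noteq> k \<or> \<beta> \<noteq> k)"
      proof (rule ccontr)
        assume "\<not> ?thesis"
        with neg have le: "\<alpha> \<le> k" "\<beta> \<le> k" by (auto simp: mult_less_0_iff not_less)
        have r: "2 * k = \<alpha> + \<beta> - 2 * sqrt (\<alpha> + \<beta> - 1)"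
          using curvature_threshold_identity(2)[OF s1, folded k_def] .
        moreover have "sqrt (\<alpha> + \<beta> - 1) \<ge> 0" using s1 by simp
        ultimately have "sqrt (\<alpha> + \<beta> - 1) = 0" using le by linarith
        then have "\<alpha> + \<beta> = 1" "\<alpha> = k" "\<beta> = k" using r le by auto
        then show False using ne by auto
      qed
      then have ab: "a \<ge> 0" "b \<ge> 0" "a > 0 \<or> b > 0"
        using p unfolding a_def b_def by (auto simp: zero_less_mult_iff)
      have "(sqrt (k / a), 0) \<in> frontier C \<or> (0, sqrt (k / b)) \<in> frontier C"
        unfolding fr using ab k by auto
      moreover have "\<not> is_hyperbola (frontier C)"
        unfolding fr by (rule not_is_hyperbola_semidefinite_conic) (use ab in auto)
      ultimately show False using F by auto
    qed
    then show ?thesis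
      using curvature_threshold_identity(1)[OF s1, folded k_def] s2
      unfolding sqrt_sum_less_sqrt2_iff[OF p] by linarith
  qed
qed

section \<open>The equivalences\<close>

theorem theorem4p2:
  fixes \<alpha> \<beta> :: real
  assumes "\<alpha> > 0" and "\<beta> > 0"
  shows "(linearly_stable_equilibrium \<alpha> \<beta> (0, 0) \<longleftrightarrow> mane_critical_value (H \<alpha> \<beta>) > e0 \<alpha> \<beta>)
    \<and> (mane_critical_value (H \<alpha> \<beta>) > e0 \<alpha> \<beta> \<longleftrightarrow> sqrt \<alpha> + sqrt \<beta> < sqrt 2)
    \<and> (sqrt \<alpha> + sqrt \<beta> < sqrt 2 \<longrightarrow> curvature_condition \<alpha> \<beta>)
    \<and> (curvature_condition \<alpha> \<beta> \<and> (\<alpha>, \<beta>) \<noteq> (1/2, 1/2) \<longrightarrow> sqrt \<alpha> + sqrt \<beta> < sqrt 2)"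
proof -
  have "mane_critical_value (H \<alpha> \<beta>) > e0 \<alpha> \<beta> \<longleftrightarrow> sqrt \<alpha> + sqrt \<beta> < sqrt 2"
    unfolding e0_eq_0[OF assms]
    using mane_critical_value_pos[OF assms] mane_critical_value_nonpos[OF assms]
    by (meson not_le)
  then show ?thesis
    using linearly_stable_iff[OF assms] curvature_condition_if_stable[OF assms]
      stable_if_curvature_condition[OF assms] by blast
qed

end
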